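(* Let $h>0$, let $(q(t),p(t),\omega(t))$ be a weak solution of the Hamiltonian system with $\omega(0)\in\Omega$ (so that $\omega(t)\in\Omega$ for all $t$). Set $$N^{appr}(t)=\frac{|q(t)|^2+|p(t)|^2}{2h},\qquad S_j^{[\lambda,appr]}(t)=\langle\omega(t),i\sigma_j^{[\lambda]}\rangle .$$ Then for all $t\in\mathbb R$, $$\frac{d}{dt}N^{appr}(t)=\sum_{\lambda=1}^N\sum_{j=1}^3\Big(E_j\big(x_\lambda,\Pi_-(q(t),p(t))\big)-E_j\big(x_\lambda,\Pi_+(q(t),p(t))\big)\Big)S_j^{[\lambda,appr]}(t),$$ where $\Pi_+$ and $\Pi_-$ are the projections onto the two circular polarization subspaces of $H^2$ defined in the context.
   Context: $H$ is the real Hilbert space of $f=(f_1,f_2,f_3):\mathbb R^3\to\mathbb R^3$ with $f_j\in L^2(\mathbb R^3)$ real valued and $k\cdot f(k)=0$ a.e., with $|f|^2=\sum_j\int|f_j(k)|^2dk$ and scalar product $\cdot$. $M$ is multiplication by $|k|$ in $H$. $\chi\in\mathcal S(\mathbb R)$ is a fixed real-valued function vanishing near $0$; $(e_1,e_2,e_3)$ is the canonical basis of $\mathbb R^3$; $\wedge$ is the cross product. For $x\in\mathbb R^3$, $m=1,2,3$, $$a_m(x)(k)=\frac{\chi(|k|)|k|^{1/2}}{(2\pi)^{3/2}}\sin(k\cdot x)\frac{k\wedge e_m}{|k|},\qquad b_m(x)(k)=\frac{\chi(|k|)|k|^{1/2}}{(2\pi)^{3/2}}\cos(k\cdot x)\frac{k\wedge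 e_m}{|k|},$$ $B_m(x,q,p)=a_m(x)\cdot q+b_m(x)\cdot p$ and $E_m(x,q,p)=-B_m(x,J(q,p))$ for $(q,p)\in H^2$, where $J:H^2\to H^2$, $J(q,p)(k)=\big(\frac{k\wedge q(k)}{|k|},\frac{k\wedge p(k)}{|k|}\big)$, is the helicity operator. Let $\mathcal F(q,p)=(-p,q)$ on $H^2$. $J$ and $\mathcal F$ commute and $J^{-1}\mathcal F$ is self-adjoint in $H^2$ with square equal to the identity; $\Pi_\pm$ denotes the orthogonal projection of $H^2$ onto the eigenspace of $J^{-1}\mathcal F$ for the eigenvalue $\pm1$. Points $x_1,\dots,x_N\in\mathbb R^3$ and $\beta=(\beta_1,\beta_2,\beta_3)\in\mathbb R^3$ are fixed. $\mathcal H_{sp}=(\mathbb C^2)^{\otimes N}$ and $\sigma_m^{[\lambda]}$ is the Pauli matrix $\sigma_m$ acting on the $\lambda$-th factor. $\mathcal G$ is the Lie algebra of $SU(2^N)=SU(\mathcal H_{sp})$ (traceless antihermitian maps), $\mathcal G^\star$ its dual; $\Omega\subset\mathcal G^\star$ is the set of forms $\pi_a:Y\mapsto i^{-1}\langle Ya,a\rangle$ with $a$ a unit vector of $\mathcal H_{sp}$. The Hamiltonian system is $q'=Mp+h\sum_{\lambda,m}b_m(x_\lambda)\langle\omega,i\sigma_m^{[\lambda]}\rangle$, $p'=-Mq-h\sum_{\lambda,m}a_m(x_\lambda)\langle\omega,i\sigma_m^{[\lambda]}\rangle$, $\frac{d}{dt}\langle\omega,Y\rangle=\sum_{\lambda,m}(\beta_m+B_m(x_\lambda,q,p))\langle\omega,[i\sigma_m^{[\lambda]},Y]\rangle$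 for all $Y\in\mathcal G$. With $R_t(q,p)=(q_t,p_t)$, $q_t(k)=\cos(t|k|)q(k)+\sin(t|k|)p(k)$, $p_t(k)=-\sin(t|k|)q(k)+\cos(t|k|)p(k)$, a weak solution is a continuous map $t\mapsto(X(t),\omega(t))$, $X=(q,p)$, from $\mathbb R$ to $H\times H\times\mathcal G^\star$ satisfying $X(t)=R_t(X(0))+\int_0^tR_{t-s}(Q(s),P(s))ds$, with $Q(s)=h\sum_{\lambda,m}b_m(x_\lambda)\langle\omega(s),i\sigma_m^{[\lambda]}\rangle$, $P(s)=-h\sum_{\lambda,m}a_m(x_\lambda)\langle\omega(s),i\sigma_m^{[\lambda]}\rangle$, and the time-integrated form of the third equation. *)

theory Defs
  imports "HOL-Analysis.Analysis"
begin

unbundle cross3_syntax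

section \<open>The real Hilbert space of transverse square integrable vector fields\<close>

definition transverse_L2 :: "(real^3 \<Rightarrow> real^3) set" where
  "transverse_L2 = {f. f \<in> borel_measurable lborel \<and> integrable lborel (\<lambda>k. (norm (f k))\<^sup>2)
      \<and> (AE k in lborel. k \<bullet> f k = 0)}"

definition tfield_rel :: "(real^3 \<Rightarrow> real^3) \<Rightarrow> (real^3 \<Rightarrow> real^3) \<Rightarrow> bool" where
  "tfield_rel f g \<longleftrightarrow> f \<in> transverse_L2 \<and> g \<in> transverse_L2 \<and> (AE k in lborel. f k = g k)"

lemma zero_in_transverse_L2: "(\<lambda>k. 0) \<in> transverse_L2"
  by (simp add: transverse_L2_def)

lemma integrable_inner_transverse_L2:
  assumes "f \<in> transverse_L2" "g \<in> transverse_L2"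
  shows "integrable lborel (\<lambda>k. f k \<bullet> g k)"
proof (rule Bochner_Integration.integrable_bound)
  show "integrable lborel (\<lambda>k. (norm (f k))\<^sup>2 + (norm (g k))\<^sup>2)"
    using assms by (auto simp: transverse_L2_def)
  show "(\<lambda>k. f k \<bullet> g k) \<in> borel_measurable lborel"
    using assms by (auto simp: transverse_L2_def)
  have "norm (f k \<bullet> g k) \<le> norm ((norm (f k))\<^sup>2 + (norm (g k))\<^sup>2)" for k
  proof -
    have "\<bar>f k \<bullet> g k\<bar> \<le> norm (f k) * norm (g k)"
      by (rule Cauchy_Schwarz_ineq2)
    moreover have "2 * (norm (f k) * norm (g k)) \<le> (norm (f k))\<^sup>2 + (norm (g k))\<^sup>2"
      using sum_squares_bound[of "norm (f k)" "norm (g k)"] by simp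
    moreover have "0 \<le> norm (f k) * norm (g k)" by simp
    ultimately have "\<bar>f k \<bullet> g k\<bar> \<le> (norm (f k))\<^sup>2 + (norm (g k))\<^sup>2" by linarith
    then show ?thesis by simp
  qed
  then show "AE k in lborel. norm (f k \<bullet> g k) \<le> norm ((norm (f k))\<^sup>2 + (norm (g k))\<^sup>2)"
    by simp
qed

lemma bounded_image_in_transverse_L2:
  assumes f: "f \<in> transverse_L2" and m: "g \<in> borel_measurable lborel"
    and b: "\<And>k. norm (g k) \<le> norm (c *\<^sub>R f k)" and t: "\<And>k. k \<bullet> f k = 0 \<Longrightarrow> k \<bullet> g k = 0"
  shows "g \<in> transverse_L2"
proof -
  have "integrable lborel (\<lambda>k. c\<^sup>2 * (norm (f k))\<^sup>2)"
    using f by (auto simp: transverse_L2_def)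
  then have "integrable lborel (\<lambda>k. (norm (g k))\<^sup>2)"
  proof (rule Bochner_Integration.integrable_bound)
    show "(\<lambda>k. (norm (g k))\<^sup>2) \<in> borel_measurable lborel" using m by measurable
    have "(norm (g k))\<^sup>2 \<le> c\<^sup>2 * (norm (f k))\<^sup>2" for k
      using power_mono[OF b[of k], of 2] by (simp add: power_mult_distrib)
    then show "AE k in lborel. norm ((norm (g k))\<^sup>2) \<le> norm (c\<^sup>2 * (norm (f k))\<^sup>2)" by simp
  qed
  moreover have "AE k in lborel. k \<bullet> g k = 0"
    using f t by (auto simp: transverse_L2_def)
  ultimately show ?thesis using m by (simp add: transverse_L2_def)
qed

lemma scaleR_in_transverse_L2: "f \<in> transverse_L2 \<Longrightarrow> (\<lambda>k. c *\<^sub>R f k) \<in> transverse_L2"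
  by (rule bounded_image_in_transverse_L2[where c = c]) (auto simp: transverse_L2_def)

lemma add_in_transverse_L2:
  assumes f: "f \<in> transverse_L2" and g: "g \<in> transverse_L2"
  shows "(\<lambda>k. f k + g k) \<in> transverse_L2"
proof -
  have "integrable lborel (\<lambda>k. (norm (f k))\<^sup>2 + (norm (g k))\<^sup>2 + 2 * (f k \<bullet> g k))"
    using integrable_inner_transverse_L2[OF f g] f g by (auto simp: transverse_L2_def)
  also have "(\<lambda>k. (norm (f k))\<^sup>2 + (norm (g k))\<^sup>2 + 2 * (f k \<bullet> g k)) = (\<lambda>k. (norm (f k + g k))\<^sup>2)"
    by (auto simp: dot_norm field_simps)
  finally have "integrable lborel (\<lambda>k. (norm (f k + g k))\<^sup>2)" .
  moreover have "AE k in lborel. k \<bullet> (f k + g k) = 0"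
    using f g by (auto simp: transverse_L2_def inner_add_right)
  moreover have "(\<lambda>k. f k + g k) \<in> borel_measurable lborel"
    using f g by (auto simp: transverse_L2_def)
  ultimately show ?thesis by (simp add: transverse_L2_def)
qed

quotient_type tfield = "real^3 \<Rightarrow> real^3" / partial: tfield_rel
proof (rule part_equivpI)
  show "\<exists>f. tfield_rel f f"
    using zero_in_transverse_L2 by (auto simp: tfield_rel_def)
  show "symp tfield_rel"
    by (auto simp: symp_def tfield_rel_def)
  show "transp tfield_rel"
  proof (rule transpI)
    fix f g h assume "tfield_rel f g" "tfield_rel g h"
    then have *: "AE k in lborel. f k = g k" "AE k in lborel. g k = h k"
      and "f \<in> transverse_L2" "h \<in> transverse_L2"
      by (simp_all add: tfield_rel_def)
    moreover from * have "AE k in lborel. f k = h k" by eventually_elim simp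
    ultimately show "tfield_rel f h" by (simp add: tfield_rel_def)
  qed
qed

instantiation tfield :: real_inner
begin

lift_definition zero_tfield :: tfield is "\<lambda>k. 0"
  by (simp add: tfield_rel_def zero_in_transverse_L2)

lift_definition plus_tfield :: "tfield \<Rightarrow> tfield \<Rightarrow> tfield" is "\<lambda>f g k. f k + g k"
  by (auto simp: tfield_rel_def add_in_transverse_L2)

lift_definition scaleR_tfield :: "real \<Rightarrow> tfield \<Rightarrow> tfield" is "\<lambda>c f k. c *\<^sub>R f k"
  by (auto simp: tfield_rel_def scaleR_in_transverse_L2)

definition uminus_tfield :: "tfield \<Rightarrow> tfield" where "uminus_tfield f = (- 1) *\<^sub>R f"
definition minus_tfield :: "tfield \<Rightarrow> tfield \<Rightarrow> tfield" where "minus_tfield f g = f + (- 1) *\<^sub>R g"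

lift_definition inner_tfield :: "tfield \<Rightarrow> tfield \<Rightarrow> real" is
  "\<lambda>f g. \<integral>k. f k \<bullet> g k \<partial>lborel"
  by (rule integral_cong_AE) (auto simp: tfield_rel_def transverse_L2_def)

definition norm_tfield :: "tfield \<Rightarrow> real" where "norm_tfield f = sqrt (inner f f)"
definition sgn_tfield :: "tfield \<Rightarrow> tfield" where "sgn_tfield f = inverse (norm f) *\<^sub>R f"
definition dist_tfield :: "tfield \<Rightarrow> tfield \<Rightarrow> real" where "dist_tfield f g = norm (f - g)"
definition uniformity_tfield :: "(tfield \<times> tfield) filter" where
  "uniformity_tfield = (INF e\<in>{0<..}. principal {(x, y). dist x y < e})"
definition open_tfield :: "tfield set \<Rightarrow> bool" where
  "open_tfield U \<longleftrightarrow> (\<forall>x\<in>U. eventually (\<lambda>(x', y). x' = x \<longrightarrow> y \<in> U) uniformity)"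

instance
proof
  fix f g h :: tfield and a b r :: real
  show "f + g + h = f + (g + h)"
    by transfer (auto simp: tfield_rel_def add_in_transverse_L2 add.assoc)
  show "f + g = g + f"
    by transfer (auto simp: tfield_rel_def add_in_transverse_L2 add.commute)
  show "0 + f = f"
    by transfer (auto simp: tfield_rel_def)
  show "- f + f = 0"
    unfolding uminus_tfield_def
    by transfer (auto simp: tfield_rel_def zero_in_transverse_L2)
  show "f - g = f + - g"
    by (simp add: minus_tfield_def uminus_tfield_def)
  show "a *\<^sub>R (f + g) = a *\<^sub>R f + a *\<^sub>R g"
    by transfer (auto simp: tfield_rel_def add_in_transverse_L2 scaleR_in_transverse_L2
        scaleR_add_right)
  show "(a + b) *\<^sub>R f = a *\<^sub>R f + b *\<^sub>R f"
    by transfer (auto simp: tfield_rel_def add_in_transverse_L2 scaleR_in_transverse_L2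
        scaleR_add_left)
  show "a *\<^sub>R b *\<^sub>R f = (a * b) *\<^sub>R f"
    by transfer (auto simp: tfield_rel_def scaleR_in_transverse_L2)
  show "1 *\<^sub>R f = f"
    by transfer (auto simp: tfield_rel_def)
  show "inner f g = inner g f"
    by transfer (simp add: inner_commute)
  show "inner (f + g) h = inner f h + inner g h"
    by transfer (auto simp: tfield_rel_def inner_add_left integrable_inner_transverse_L2)
  show "inner (r *\<^sub>R f) g = r * inner f g"
    by transfer (auto simp: tfield_rel_def)
  show "0 \<le> inner f f"
    by transfer simp
  show "inner f f = 0 \<longleftrightarrow> f = 0"
  proof transfer
    fix f assume "tfield_rel f f"
    then have f: "f \<in> transverse_L2" by (simp add: tfield_rel_def)
    have "(\<integral>k. f k \<bullet> f k \<partial>lborel) = 0 \<longleftrightarrow> (AE k in lborel. f k \<bullet> f k = 0)"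
      by (rule integral_nonneg_eq_0_iff_AE) (auto intro: integrable_inner_transverse_L2 f)
    then show "(\<integral>k. f k \<bullet> f k \<partial>lborel) = 0 \<longleftrightarrow> tfield_rel f (\<lambda>k. 0)"
      using f by (simp add: tfield_rel_def zero_in_transverse_L2)
  qed
  show "norm f = sqrt (inner f f)" by (rule norm_tfield_def)
  show "sgn f = inverse (norm f) *\<^sub>R f" by (rule sgn_tfield_def)
  show "dist f g = norm (f - g)" by (rule dist_tfield_def)
  show "(uniformity :: (tfield \<times> tfield) filter) = (INF e\<in>{0<..}. principal {(x, y). dist x y < e})"
    by (rule uniformity_tfield_def)
  show "open U \<longleftrightarrow> (\<forall>x\<in>U. eventually (\<lambda>(x', y). x' = x \<longrightarrow> y \<in> U) uniformity)" for U :: "tfield set"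
    by (rule open_tfield_def)
qed

end

section \<open>Operators on the field space\<close>

lemma borel_measurable_cross3 [measurable]:
  assumes [measurable]: "f \<in> borel_measurable M" "g \<in> borel_measurable M"
  shows "(\<lambda>k. f k \<times> g k) \<in> borel_measurable M"
proof -
  have "continuous_on UNIV (\<lambda>z::(real^3) \<times> (real^3). fst z \<times> snd z)"
    by (intro continuous_on_cross continuous_intros)
  then have "(\<lambda>z::(real^3) \<times> (real^3). fst z \<times> snd z) \<in> borel_measurable borel"
    by (rule borel_measurable_continuous_onI)
  then have "(\<lambda>z::(real^3) \<times> (real^3). fst z \<times> snd z) \<in> borel_measurable (borel \<Otimes>\<^sub>M borel)"
    by (simp add: borel_prod)
  from measurable_compose[OF _ this, of "\<lambda>k. (f k, g k)" M] show ?thesis by simp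
qed

lemma norm_cross3_le: "norm (u \<times> v) \<le> norm u * norm v"
proof (rule power2_le_imp_le)
  show "(norm (u \<times> v))\<^sup>2 \<le> (norm u * norm v)\<^sup>2"
    using norm_cross_dot[of u v] zero_le_power2[of "u \<bullet> v"] by linarith
qed simp

lemma lift_bounded_image:
  assumes fg: "tfield_rel f g"
    and m: "\<And>f. f \<in> borel_measurable lborel \<Longrightarrow> (\<lambda>k. T k (f k)) \<in> borel_measurable lborel"
    and b: "\<And>k v. norm (T k v) \<le> norm v" and t: "\<And>k v. k \<bullet> v = 0 \<Longrightarrow> k \<bullet> T k v = 0"
  shows "tfield_rel (\<lambda>k. T k (f k)) (\<lambda>k. T k (g k))"
proof -
  have "(\<lambda>k. T k (u k)) \<in> transverse_L2" if "u \<in> transverse_L2" for u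
    by (rule bounded_image_in_transverse_L2[where c = 1, OF that])
       (use that m b t in \<open>auto simp: transverse_L2_def\<close>)
  then show ?thesis using fg by (auto simp: tfield_rel_def)
qed

lift_definition cos_mult :: "real \<Rightarrow> tfield \<Rightarrow> tfield" is
  "\<lambda>t f k. cos (t * norm k) *\<^sub>R f k"
  subgoal for t f g
    by (rule lift_bounded_image[where T = "\<lambda>k v. cos (t * norm k) *\<^sub>R v"])
       (auto intro: mult_left_le_one_le)
  done

lift_definition sin_mult :: "real \<Rightarrow> tfield \<Rightarrow> tfield" is
  "\<lambda>t f k. sin (t * norm k) *\<^sub>R f k"
  subgoal for t f g
    by (rule lift_bounded_image[where T = "\<lambda>k v. sin (t * norm k) *\<^sub>R v"])
       (auto intro: mult_left_le_one_le)
  done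

lift_definition helicity1 :: "tfield \<Rightarrow> tfield" is "\<lambda>f k. (k \<times> f k) /\<^sub>R norm k"
  subgoal for f g
  proof (rule lift_bounded_image[where T = "\<lambda>k v. (k \<times> v) /\<^sub>R norm k"])
    show "norm ((k \<times> v) /\<^sub>R norm k) \<le> norm v" for k v
      using norm_cross3_le[of k v] by (cases "k = 0") (auto simp: field_simps)
  qed (auto simp: dot_cross_self)
  done

fun free_flow :: "real \<Rightarrow> tfield \<times> tfield \<Rightarrow> tfield \<times> tfield" where
  "free_flow t (q, p) = (cos_mult t q + sin_mult t p, - sin_mult t q + cos_mult t p)"

fun helicity :: "tfield \<times> tfield \<Rightarrow> tfield \<times> tfield" where
  "helicity (q, p) = (helicity1 q, helicity1 p)"

fun symplectic_map :: "tfield \<times> tfield \<Rightarrow> tfield \<times> tfield" where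
  "symplectic_map (q, p) = (- p, q)"

definition eigenspace :: "('a::real_vector \<Rightarrow> 'a) \<Rightarrow> real \<Rightarrow> 'a set" where
  "eigenspace T c = {X. T X = c *\<^sub>R X}"

definition orthogonal_proj :: "'a::real_inner set \<Rightarrow> 'a \<Rightarrow> 'a" where
  "orthogonal_proj S X = (THE Y. Y \<in> S \<and> (\<forall>Z\<in>S. (X - Y) \<bullet> Z = 0))"

definition Pi_plus :: "tfield \<times> tfield \<Rightarrow> tfield \<times> tfield" where
  "Pi_plus = orthogonal_proj (eigenspace (inv helicity \<circ> symplectic_map) 1)"

definition Pi_minus :: "tfield \<times> tfield \<Rightarrow> tfield \<times> tfield" where
  "Pi_minus = orthogonal_proj (eigenspace (inv helicity \<circ> symplectic_map) (- 1))"

section \<open>Coupling functions\<close>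

definition schwartz :: "(real \<Rightarrow> real) \<Rightarrow> bool" where
  "schwartz f \<longleftrightarrow> (\<forall>n r. (deriv ^^ n) f field_differentiable at r)
      \<and> (\<forall>m n. bounded (range (\<lambda>r. r ^ m * (deriv ^^ n) f r)))"

definition a_fun :: "(real \<Rightarrow> real) \<Rightarrow> 3 \<Rightarrow> real^3 \<Rightarrow> real^3 \<Rightarrow> real^3" where
  "a_fun chi m x k = (chi (norm k) * norm k powr (1/2) / (2 * pi) powr (3/2) * sin (k \<bullet> x))
      *\<^sub>R ((k \<times> axis m 1) /\<^sub>R norm k)"

definition b_fun :: "(real \<Rightarrow> real) \<Rightarrow> 3 \<Rightarrow> real^3 \<Rightarrow> real^3 \<Rightarrow> real^3" where
  "b_fun chi m x k = (chi (norm k) * norm k powr (1/2) / (2 * pi) powr (3/2) * cos (k \<bullet> x))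
      *\<^sub>R ((k \<times> axis m 1) /\<^sub>R norm k)"

text \<open>For a Schwartz function \<open>chi\<close> these functions lie in \<open>transverse_L2\<close>
  (\<open>coupling_in_transverse_L2\<close> below), so that \<open>abs_tfield\<close> yields their classes.\<close>

definition a_vec :: "(real \<Rightarrow> real) \<Rightarrow> 3 \<Rightarrow> real^3 \<Rightarrow> tfield" where
  "a_vec chi m x = abs_tfield (a_fun chi m x)"

definition b_vec :: "(real \<Rightarrow> real) \<Rightarrow> 3 \<Rightarrow> real^3 \<Rightarrow> tfield" where
  "b_vec chi m x = abs_tfield (b_fun chi m x)"

fun B_field :: "(real \<Rightarrow> real) \<Rightarrow> 3 \<Rightarrow> real^3 \<Rightarrow> tfield \<times> tfield \<Rightarrow> real" where
  "B_field chi m x (q, p) = a_vec chi m x \<bullet> q + b_vec chi m x \<bullet> p"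

definition E_field :: "(real \<Rightarrow> real) \<Rightarrow> 3 \<Rightarrow> real^3 \<Rightarrow> tfield \<times> tfield \<Rightarrow> real" where
  "E_field chi m x X = - B_field chi m x (helicity X)"

lemma integrable_decay_R3: "integrable lborel (\<lambda>k::real^3. 1 / (1 + norm k) ^ 5)"
proof (rule integrableI_bounded)
  show "(\<lambda>k::real^3. 1 / (1 + norm k) ^ 5) \<in> borel_measurable lborel" by measurable
  define V where "V = unit_ball_vol 3"
  have V: "V \<ge> 0" by (simp add: V_def)
  define g where "g n k = ennreal (1 / real (Suc n) ^ 5) * indicator (ball 0 (real (Suc n))) k"
    for n and k :: "real^3"
  have le: "ennreal (norm (1 / (1 + norm k) ^ 5)) \<le> (\<Sum>n. g n k)" for k :: "real^3"
  proof -
    define n where "n = nat \<lfloor>norm k\<rfloor>"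
    have n: "real n \<le> norm k" "norm k < real (Suc n)"
      unfolding n_def by (auto simp: of_nat_floor) linarith
    have "1 / (1 + norm k) ^ 5 \<le> 1 / real (Suc n) ^ 5"
      using n by (intro divide_left_mono power_mono mult_pos_pos zero_less_power) auto
    then have "ennreal (norm (1 / (1 + norm k) ^ 5)) \<le> g n k"
      using n by (simp add: g_def ennreal_leI)
    also have "g n k \<le> (\<Sum>n. g n k)"
      using sum_le_suminf[of "\<lambda>n. g n k" "{n}"] by simp
    finally show ?thesis .
  qed
  have em: "(\<integral>\<^sup>+k. g n k \<partial>lborel) = ennreal (V * (1 / real (Suc n) ^ 2))" for n
  proof -
    have "(\<integral>\<^sup>+k. g n k \<partial>lborel)
        = ennreal (1 / real (Suc n) ^ 5) * emeasure lborel (ball (0::real^3) (real (Suc n)))"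
      unfolding g_def by (simp add: nn_integral_cmult_indicator)
    also have "emeasure lborel (ball (0::real^3) (real (Suc n))) = ennreal (V * real (Suc n) ^ 3)"
      by (subst emeasure_ball) (auto simp: V_def)
    also have "ennreal (1 / real (Suc n) ^ 5) * ennreal (V * real (Suc n) ^ 3)
        = ennreal (1 / real (Suc n) ^ 5 * (V * real (Suc n) ^ 3))"
      using V by (subst ennreal_mult) auto
    also have "1 / real (Suc n) ^ 5 * (V * real (Suc n) ^ 3) = V * (1 / real (Suc n) ^ 2)"
      by (simp add: field_simps power_numeral_reduce del: of_nat_Suc)
    finally show ?thesis .
  qed
  have sm: "summable (\<lambda>n. V * (1 / real (Suc n) ^ 2))"
  proof -
    have "summable (\<lambda>n. inverse (real n ^ 2))" by (rule inverse_power_summable) simp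
    then have "summable (\<lambda>n. inverse (real (Suc n) ^ 2))" by (subst summable_Suc_iff)
    then show ?thesis by (intro summable_mult) (simp add: field_simps)
  qed
  have "(\<integral>\<^sup>+k. ennreal (norm (1 / (1 + norm k) ^ 5)) \<partial>(lborel :: (real^3) measure))
      \<le> (\<integral>\<^sup>+k. (\<Sum>n. g n k) \<partial>lborel)"
    by (intro nn_integral_mono le)
  also have "\<dots> = (\<Sum>n. \<integral>\<^sup>+k. g n k \<partial>lborel)"
    unfolding g_def by (rule nn_integral_suminf) (auto intro!: borel_measurable_times_ennreal borel_measurable_indicator)
  also have "\<dots> = ennreal (\<Sum>n. V * (1 / real (Suc n) ^ 2))"
    unfolding em using V sm by (intro suminf_ennreal2) auto
  also have "\<dots> < \<infinity>" by simp
  finally show "(\<integral>\<^sup>+k. ennreal (norm (1 / (1 + norm k) ^ 5)) \<partial>(lborel :: (real^3) measure)) < \<infinity>" .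
qed

lemma schwartz_continuous: "schwartz f \<Longrightarrow> continuous_on UNIV f"
  unfolding schwartz_def
  by (auto intro!: continuous_at_imp_continuous_on field_differentiable_imp_continuous_at
      dest: spec[of _ 0])

lemma coupling_in_transverse_L2:
  assumes "schwartz chi"
  shows "a_fun chi m x \<in> transverse_L2" "b_fun chi m x \<in> transverse_L2"
proof -
  have chi [measurable]: "chi \<in> borel_measurable borel"
    using schwartz_continuous[OF assms] by (rule borel_measurable_continuous_onI)
  have bd: "\<exists>C. \<forall>r. \<bar>r ^ j * chi r\<bar> \<le> C" for j
  proof -
    have "bounded (range (\<lambda>r. r ^ j * (deriv ^^ 0) chi r))"
      using assms unfolding schwartz_def by blast
    then show ?thesis by (auto simp: bounded_iff)
  qed
  obtain C0 C3 where C0: "\<And>r. \<bar>r ^ 0 * chi r\<bar> \<le> C0" and C3: "\<And>r. \<bar>r ^ 3 * chi r\<bar> \<le> C3"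
    using bd[of 0] bd[of 3] by blast
  define C where "C = 8 * (C0 + C3)"
  have "0 \<le> C0" "0 \<le> C3" using C0[of 0] C3[of 0] by auto
  have dec: "\<bar>chi r\<bar> * (1 + r) ^ 3 \<le> C" if "r \<ge> 0" for r
  proof -
    have "(1 + r) ^ 3 \<le> 8 * (1 + r ^ 3)"
    proof (cases "r \<le> 1")
      case True
      have "(1 + r) ^ 3 \<le> 8" using power_mono[of "1 + r" 2 3] that True by simp
      also have "8 \<le> 8 * (1 + r ^ 3)" using that by simp
      finally show ?thesis .
    next
      case False
      have "(1 + r) ^ 3 \<le> (2 * r) ^ 3" using that False by (intro power_mono) auto
      then show ?thesis by (simp add: power_mult_distrib)
    qed
    then have "\<bar>chi r\<bar> * (1 + r) ^ 3 \<le> \<bar>chi r\<bar> * (8 * (1 + r ^ 3))"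
      by (rule mult_left_mono) simp
    also have "\<dots> = 8 * (\<bar>r ^ 0 * chi r\<bar> + \<bar>r ^ 3 * chi r\<bar>)"
      using that by (simp add: abs_mult algebra_simps)
    also have "\<dots> \<le> C" using C0[of r] C3[of r] by (simp add: C_def)
    finally show ?thesis .
  qed
  have main: "(\<lambda>k. (chi (norm k) * norm k powr (1/2) / (2 * pi) powr (3/2) * u k)
      *\<^sub>R ((k \<times> axis m 1) /\<^sub>R norm k)) \<in> transverse_L2"
    if [measurable]: "u \<in> borel_measurable borel" and u1: "\<And>k. \<bar>u k\<bar> \<le> 1" for u :: "real^3 \<Rightarrow> real"
  proof -
    define f where "f = (\<lambda>k. (chi (norm k) * norm k powr (1/2) / (2 * pi) powr (3/2) * u k)
      *\<^sub>R ((k \<times> axis m 1) /\<^sub>R norm k))"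
    have fm [measurable]: "f \<in> borel_measurable lborel"
      unfolding f_def by measurable
    define K where "K = C / (2 * pi) powr (3/2)"
    have "integrable lborel (\<lambda>k::real^3. K\<^sup>2 * (1 / (1 + norm k) ^ 5))"
      by (intro integrable_mult_right integrable_decay_R3)
    then have "integrable lborel (\<lambda>k. (norm (f k))\<^sup>2)"
    proof (rule Bochner_Integration.integrable_bound)
      show "(\<lambda>k. (norm (f k))\<^sup>2) \<in> borel_measurable lborel" by measurable
      have "(norm (f k))\<^sup>2 \<le> K\<^sup>2 * (1 / (1 + norm k) ^ 5)" for k
      proof -
        define r where "r = norm k"
        have r: "r \<ge> 0" by (simp add: r_def)
        have 1: "norm ((k \<times> axis m 1) /\<^sub>R norm k) \<le> 1"
          using norm_cross3_le[of k "axis m 1"]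
          by (cases "k = 0") (auto simp: norm_axis_1 field_simps)
        have "norm (f k) = \<bar>chi r\<bar> * r powr (1/2) / (2 * pi) powr (3/2) * \<bar>u k\<bar>
            * norm ((k \<times> axis m 1) /\<^sub>R norm k)"
          by (simp add: f_def r_def abs_mult)
        also have "\<dots> \<le> \<bar>chi r\<bar> * r powr (1/2) / (2 * pi) powr (3/2) * 1 * 1"
          by (intro mult_mono u1 1) auto
        finally have "(norm (f k))\<^sup>2 \<le> (\<bar>chi r\<bar> * r powr (1/2) / (2 * pi) powr (3/2))\<^sup>2"
          by (intro power_mono) auto
        also have "\<dots> = \<bar>chi r\<bar>\<^sup>2 * r / ((2 * pi) powr (3/2))\<^sup>2"
          using r by (simp add: power_divide power_mult_distrib powr_half_sqrt)
        also have "\<dots> \<le> (C / (1 + r) ^ 3)\<^sup>2 * (1 + r) / ((2 * pi) powr (3/2))\<^sup>2"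
        proof (intro divide_right_mono mult_mono power_mono)
          show "\<bar>chi r\<bar> \<le> C / (1 + r) ^ 3" using dec[OF r] r by (simp add: field_simps)
        qed (use r in auto)
        also have "\<dots> = K\<^sup>2 * ((1 + r) / ((1 + r) ^ 3)\<^sup>2)"
          by (simp add: K_def power_divide)
        also have "(1 + r) / ((1 + r) ^ 3)\<^sup>2 = 1 / (1 + r) ^ 5"
        proof -
          have "((1 + r) ^ 3)\<^sup>2 = (1 + r) * (1 + r) ^ 5"
            by (simp flip: power_mult power_Suc)
          then show ?thesis using r by simp
        qed
        finally show ?thesis by (simp add: r_def)
      qed
      then show "AE k in lborel. norm ((norm (f k))\<^sup>2) \<le> norm (K\<^sup>2 * (1 / (1 + norm k) ^ 5))"
        by simp
    qed
    moreover have "AE k in lborel. k \<bullet> f k = 0"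
      by (simp add: f_def dot_cross_self)
    ultimately have "f \<in> transverse_L2" using fm by (simp add: transverse_L2_def)
    then show ?thesis by (simp add: f_def)
  qed
  show "a_fun chi m x \<in> transverse_L2"
    unfolding a_fun_def[abs_def] by (rule main) auto
  show "b_fun chi m x \<in> transverse_L2"
    unfolding b_fun_def[abs_def] by (rule main) auto
qed

section \<open>Spin space and the Lie algebra of $SU(2^N)$\<close>

text \<open>\<open>(\<complex>\<^sup>2)\<^sup>\<otimes>\<^sup>N\<close> is \<open>complex ^ ('n \<Rightarrow> 2)\<close> with \<open>N = CARD('n)\<close>: the coordinate at
  \<open>s :: 'n \<Rightarrow> 2\<close> belongs to the tensor product of the canonical basis vectors \<open>e\<^bsub>s \<mu>\<^esub>\<close>.\<close>

type_synonym 'n spin = "complex ^ ('n \<Rightarrow> 2)"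
type_synonym 'n spin_matrix = "complex ^ ('n \<Rightarrow> 2) ^ ('n \<Rightarrow> 2)"

definition conj_transpose :: "complex^'m^'m \<Rightarrow> complex^'m^'m" where
  "conj_transpose A = (\<chi> i j. cnj (A $ j $ i))"

typedef (overloaded) ('n::finite) su =
  "{Y :: 'n spin_matrix. trace Y = 0 \<and> conj_transpose Y = - Y}"
  morphisms su_matrix Abs_su
  by (rule exI[of _ 0]) (simp add: trace_def conj_transpose_def vec_eq_iff)

setup_lifting type_definition_su

instantiation su :: (finite) real_normed_vector
begin

lift_definition zero_su :: "'a su" is 0
  by (simp add: trace_def conj_transpose_def vec_eq_iff)

lift_definition plus_su :: "'a su \<Rightarrow> 'a su \<Rightarrow> 'a su" is "(+)"
  by (simp add: trace_add conj_transpose_def vec_eq_iff)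

lift_definition minus_su :: "'a su \<Rightarrow> 'a su \<Rightarrow> 'a su" is "(-)"
  by (simp add: trace_sub conj_transpose_def vec_eq_iff)

lift_definition uminus_su :: "'a su \<Rightarrow> 'a su" is "uminus"
  by (simp add: trace_def sum_negf conj_transpose_def vec_eq_iff)

lift_definition scaleR_su :: "real \<Rightarrow> 'a su \<Rightarrow> 'a su" is "scaleR"
  by (simp add: trace_def conj_transpose_def vec_eq_iff flip: scaleR_sum_right)

lift_definition norm_su :: "'a su \<Rightarrow> real" is norm .

definition sgn_su :: "'a su \<Rightarrow> 'a su" where "sgn_su Y = inverse (norm Y) *\<^sub>R Y"
definition dist_su :: "'a su \<Rightarrow> 'a su \<Rightarrow> real" where "dist_su Y Z = norm (Y - Z)"
definition uniformity_su :: "('a su \<times> 'a su) filter" where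
  "uniformity_su = (INF e\<in>{0<..}. principal {(x, y). dist x y < e})"
definition open_su :: "'a su set \<Rightarrow> bool" where
  "open_su U \<longleftrightarrow> (\<forall>x\<in>U. eventually (\<lambda>(x', y). x' = x \<longrightarrow> y \<in> U) uniformity)"

instance
proof
  fix X Y Z :: "'a su" and a b :: real
  show "X + Y + Z = X + (Y + Z)" by transfer (rule add.assoc)
  show "X + Y = Y + X" by transfer (rule add.commute)
  show "0 + X = X" by transfer simp
  show "- X + X = 0" by transfer simp
  show "X - Y = X + - Y" by transfer simp
  show "a *\<^sub>R (X + Y) = a *\<^sub>R X + a *\<^sub>R Y" by transfer (rule scaleR_add_right)
  show "(a + b) *\<^sub>R X = a *\<^sub>R X + b *\<^sub>R X" by transfer (rule scaleR_add_left)
  show "a *\<^sub>R b *\<^sub>R X = (a * b) *\<^sub>R X" by transfer simp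
  show "1 *\<^sub>R X = X" by transfer simp
  show "norm X = 0 \<longleftrightarrow> X = 0" by transfer simp
  show "norm (X + Y) \<le> norm X + norm Y" by transfer (rule norm_triangle_ineq)
  show "norm (a *\<^sub>R X) = \<bar>a\<bar> * norm X" by transfer simp
  show "sgn X = inverse (norm X) *\<^sub>R X" by (rule sgn_su_def)
  show "dist X Y = norm (X - Y)" by (rule dist_su_def)
  show "(uniformity :: ('a su \<times> 'a su) filter) = (INF e\<in>{0<..}. principal {(x, y). dist x y < e})"
    by (rule uniformity_su_def)
  show "open U \<longleftrightarrow> (\<forall>x\<in>U. eventually (\<lambda>(x', y). x' = x \<longrightarrow> y \<in> U) uniformity)" for U :: "'a su set"
    by (rule open_su_def)
qed

end

lemma conj_transpose_mult: "conj_transpose (A ** B) = conj_transpose B ** conj_transpose A"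
  by (simp add: conj_transpose_def matrix_matrix_mult_def vec_eq_iff mult.commute)

lift_definition lie_bracket :: "'n::finite su \<Rightarrow> 'n su \<Rightarrow> 'n su" is "\<lambda>A B. A ** B - B ** A"
proof -
  fix A B :: "'n spin_matrix"
  assume A: "trace A = 0 \<and> conj_transpose A = - A" and B: "trace B = 0 \<and> conj_transpose B = - B"
  have "conj_transpose (A ** B - B ** A)
      = conj_transpose B ** conj_transpose A - conj_transpose A ** conj_transpose B"
    unfolding conj_transpose_mult[symmetric] by (simp add: conj_transpose_def vec_eq_iff)
  also have "\<dots> = - (A ** B - B ** A)"
    using A B by (simp add: matrix_matrix_mult_def vec_eq_iff)
  finally show "trace (A ** B - B ** A) = 0 \<and> conj_transpose (A ** B - B ** A) = - (A ** B - B ** A)"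
    by (simp add: trace_sub trace_mul_sym[of A B])
qed

definition pauli :: "3 \<Rightarrow> complex^2^2" where
  "pauli m = (if m = 1 then vector [vector [0, 1], vector [1, 0]]
     else if m = 2 then vector [vector [0, - \<i>], vector [\<i>, 0]]
     else vector [vector [1, 0], vector [0, - 1]])"

text \<open>The matrix of \<open>I \<otimes> \<dots> \<otimes> \<sigma>\<^sub>m \<otimes> \<dots> \<otimes> I\<close>, with \<open>\<sigma>\<^sub>m\<close> in position \<open>l\<close>.\<close>

definition spin_op :: "'n \<Rightarrow> 3 \<Rightarrow> 'n::finite spin_matrix" where
  "spin_op l m = (\<chi> s s'. \<Prod>\<mu>\<in>UNIV. (if \<mu> = l then pauli m else mat 1) $ s \<mu> $ s' \<mu>)"

lemma trace_pauli: "trace (pauli m) = 0"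
  by (simp add: trace_def pauli_def sum_2 vector_2)

lemma cnj_pauli: "cnj (pauli m $ i $ j) = pauli m $ j $ i"
  using exhaust_2[of i] exhaust_2[of j] by (auto simp: pauli_def vector_2)

lift_definition i_sigma :: "'n \<Rightarrow> 3 \<Rightarrow> 'n::finite su" is "\<lambda>l m. \<chi> s s'. \<i> * spin_op l m $ s $ s'"
proof -
  fix l :: 'n and m
  have "trace (spin_op l m) = (\<Sum>s\<in>PiE UNIV (\<lambda>_. UNIV). \<Prod>\<mu>\<in>UNIV.
      (if \<mu> = l then pauli m else mat 1) $ s \<mu> $ s \<mu>)"
    by (simp add: trace_def spin_op_def)
  also have "\<dots> = (\<Prod>\<mu>\<in>UNIV. trace (if \<mu> = l then pauli m else mat 1))"
    unfolding trace_def by (rule prod_sum_PiE[symmetric]) auto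
  also have "\<dots> = 0"
    by (rule prod_zero) (auto intro!: exI[of _ l] simp: trace_pauli)
  finally have "(\<Sum>s\<in>UNIV. spin_op l m $ s $ s) = 0" by (simp add: trace_def)
  then have "trace (\<chi> s s'. \<i> * spin_op l m $ s $ s') = 0"
    by (simp add: trace_def flip: sum_distrib_left)
  moreover have "cnj (spin_op l m $ s $ s') = spin_op l m $ s' $ s" for s s'
    unfolding spin_op_def by (auto intro!: prod.cong simp: cnj_pauli mat_def)
  ultimately show "trace (\<chi> s s'. \<i> * spin_op l m $ s $ s') = 0 \<and>
      conj_transpose (\<chi> s s'. \<i> * spin_op l m $ s $ s') = - (\<chi> s s'. \<i> * spin_op l m $ s $ s')"
    by (simp add: conj_transpose_def vec_eq_iff)
qed

text \<open>The dual of \<open>'n su\<close> is \<open>'n su \<Rightarrow>\<^sub>L real\<close>; since \<open>'n su\<close> is finite-dimensional, every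
  linear form is bounded.\<close>

definition hermitian_inner :: "'n::finite spin \<Rightarrow> 'n spin \<Rightarrow> complex" where
  "hermitian_inner u v = (\<Sum>s\<in>UNIV. u $ s * cnj (v $ s))"

definition Omega :: "('n::finite su \<Rightarrow>\<^sub>L real) set" where
  "Omega = {\<omega>. \<exists>a. hermitian_inner a a = 1 \<and>
      (\<forall>Y. complex_of_real (blinfun_apply \<omega> Y) = inverse \<i> * hermitian_inner (su_matrix Y *v a) a)}"

section \<open>Weak solutions of the Hamiltonian system\<close>

text \<open>The integral from \<open>a\<close> to \<open>b\<close>, with the usual sign convention when \<open>b < a\<close>.\<close>

definition has_oriented_integral ::
    "(real \<Rightarrow> 'b::real_normed_vector) \<Rightarrow> 'b \<Rightarrow> real \<Rightarrow> real \<Rightarrow> bool" where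
  "has_oriented_integral f I a b \<longleftrightarrow>
     (if a \<le> b then (f has_integral I) {a..b} else (f has_integral (- I)) {b..a})"

definition weak_solution :: "(real \<Rightarrow> real) \<Rightarrow> real \<Rightarrow> real^3 \<Rightarrow> ('n::finite \<Rightarrow> real^3) \<Rightarrow>
    (real \<Rightarrow> tfield) \<Rightarrow> (real \<Rightarrow> tfield) \<Rightarrow> (real \<Rightarrow> ('n su \<Rightarrow>\<^sub>L real)) \<Rightarrow> bool" where
  "weak_solution chi h \<beta> x q p \<omega> \<longleftrightarrow>
     continuous_on UNIV (\<lambda>t. ((q t, p t), \<omega> t)) \<and>
     (let Q = (\<lambda>s. h *\<^sub>R (\<Sum>l\<in>UNIV. \<Sum>m\<in>UNIV. blinfun_apply (\<omega> s) (i_sigma l m) *\<^sub>R b_vec chi m (x l)));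
          P = (\<lambda>s. - (h *\<^sub>R (\<Sum>l\<in>UNIV. \<Sum>m\<in>UNIV. blinfun_apply (\<omega> s) (i_sigma l m) *\<^sub>R a_vec chi m (x l))))
      in \<forall>t. has_oriented_integral (\<lambda>s. free_flow (t - s) (Q s, P s))
               ((q t, p t) - free_flow t (q 0, p 0)) 0 t) \<and>
     (\<forall>t Y. has_oriented_integral
        (\<lambda>s. \<Sum>l\<in>UNIV. \<Sum>m\<in>UNIV. (\<beta> $ m + B_field chi m (x l) (q s, p s))
            * blinfun_apply (\<omega> s) (lie_bracket (i_sigma l m) Y))
        (blinfun_apply (\<omega> t) Y - blinfun_apply (\<omega> 0) Y) 0 t)"

definition N_appr :: "real \<Rightarrow> tfield \<Rightarrow> tfield \<Rightarrow> real" where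
  "N_appr h q p = ((norm q)\<^sup>2 + (norm p)\<^sup>2) / (2 * h)"

definition S_appr :: "('n::finite su \<Rightarrow>\<^sub>L real) \<Rightarrow> 'n \<Rightarrow> 3 \<Rightarrow> real" where
  "S_appr \<omega> l j = blinfun_apply \<omega> (i_sigma l j)"

unbundle no cross3_syntax

end

theory Submission
  imports Defs
begin

text \<open>Undoing the free flow, \<open>Y(t) = R\<^sub>-\<^sub>t X(t)\<close>, turns the weak formulation into
  \<open>Y' = R\<^sub>-\<^sub>t (Q, P)\<close>; since \<open>R\<^sub>t\<close> is orthogonal, \<open>(|X|\<^sup>2)' = 2 X \<cdot> (Q, P)\<close>, which is a sum of terms
  \<open>B\<^sub>j(x\<^sub>\<lambda>, \<F> X)\<close>. As \<open>J\<^sup>2 = -1\<close>, the operator \<open>T = J\<^sup>-\<^sup>1 \<F>\<close> is a symmetric involution with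
  \<open>\<Pi>\<^sub>\<plusminus> = (1 \<plusminus> T) / 2\<close>, whence \<open>J (\<Pi>\<^sub>+ - \<Pi>\<^sub>-) = \<F>\<close>.

  For the invariance of \<open>\<Omega>\<close>, represent \<open>\<omega>\<close> by a Hermitian matrix \<open>\<rho>\<close> of trace one with
  \<open>\<langle>\<omega>, Y\<rangle> = -i tr (Y \<rho>)\<close>. Then \<open>\<omega> \<in> \<Omega>\<close> means \<open>\<rho>\<^sup>2 = \<rho>\<close>, and \<open>\<rho>' = [\<rho>, A]\<close> with \<open>A\<close>
  antihermitian. Hence \<open>D = \<rho>\<^sup>2 - \<rho>\<close> satisfies \<open>D' = [D, A]\<close>, its Hilbert--Schmidt norm is
  constant, and \<open>D\<close> vanishes identically if it vanishes at time \<open>0\<close>.\<close>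

unbundle cross3_syntax

section \<open>Oriented integrals\<close>

lemma has_oriented_integral_linear:
  assumes "has_oriented_integral f I a b" "bounded_linear L"
  shows "has_oriented_integral (\<lambda>s. L (f s)) (L I) a b"
  using has_integral_linear[OF _ assms(2), of f I "{a..b}"]
    has_integral_linear[OF _ assms(2), of f "- I" "{b..a}"] assms(1)
    linear_neg[OF bounded_linear.linear[OF assms(2)]]
  by (simp add: has_oriented_integral_def o_def split: if_splits)

lemma has_oriented_integral_unique:
  assumes "has_oriented_integral f I a b" "has_oriented_integral f J a b"
  shows "I = J"
  using assms by (auto simp: has_oriented_integral_def dest: has_integral_unique split: if_splits)

text \<open>A continuous real \<open>f\<close> has an antiderivative on every compact interval. By
  uniqueness of the integral \<open>Y\<close> differs from it by a constant there, at negative times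
  too, and so inherits its derivative.\<close>

lemma has_oriented_integral_derivative_real:
  fixes f Y :: "real \<Rightarrow> real"
  assumes f: "continuous_on UNIV f"
    and Y: "\<And>t. has_oriented_integral f (Y t - c) 0 t"
  shows "(Y has_real_derivative f t) (at t)"
proof -
  \<comment> \<open>The margin \<open>1\<close> puts both \<open>0\<close> and \<open>t\<close> in
    the interior of the interval.\<close>
  define T where "T = \<bar>t\<bar> + 1"
  obtain g where g: "\<And>s. s \<in> {-T..T} \<Longrightarrow> (g has_vector_derivative f s) (at s within {-T..T})"
    using antiderivative_continuous[of "-T" T f] continuous_on_subset[OF f] by blast
  have eq: "Y s = c + (g s - g 0)" if s: "s \<in> {-T..T}" for s
  proof -
    have "has_oriented_integral f (g s - g 0) 0 s"
    proof (cases "0 \<le> s")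
      case True
      then have "(f has_integral (g s - g 0)) {0..s}"
        using s by (intro fundamental_theorem_of_calculus has_vector_derivative_within_subset[OF g]) auto
      with True show ?thesis by (simp add: has_oriented_integral_def)
    next
      case False
      then have "(f has_integral (g 0 - g s)) {s..0}"
        using s by (intro fundamental_theorem_of_calculus has_vector_derivative_within_subset[OF g]) auto
      with False show ?thesis by (simp add: has_oriented_integral_def)
    qed
    from has_oriented_integral_unique[OF Y this] show ?thesis by simp
  qed
  have "(g has_real_derivative f t) (at t within {-T<..<T})"
    unfolding has_real_derivative_iff_has_vector_derivative
    by (rule has_vector_derivative_within_subset[OF g]) (auto simp: T_def)
  moreover have t: "t \<in> {-T<..<T}" by (auto simp: T_def)
  ultimately have "(g has_real_derivative f t) (at t)"
    by (simp add: at_within_open[OF t])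
  then have "((\<lambda>s. c + (g s - g 0)) has_real_derivative f t) (at t)"
    by (auto intro!: derivative_eq_intros)
  then show ?thesis
    by (rule DERIV_cong_ev[THEN iffD1, rotated -1])
       (auto simp: eq intro!: eventually_mono[OF eventually_nhds_in_open[OF _ t]])
qed

text \<open>The values may lie in an incomplete space, where continuity does not give integrability on
  subintervals; testing against a vector reduces the claim to real-valued integrands, and the
  mean value estimate for the test vector \<open>Y s - Y t - (s - t) f t\<close> makes it strong.\<close>

lemma has_oriented_integral_derivative:
  fixes f Y :: "real \<Rightarrow> 'a::real_inner"
  assumes f: "continuous_on UNIV f"
    and Y: "\<And>t. has_oriented_integral f (Y t - c) 0 t"
  shows "(Y has_vector_derivative f t) (at t)"
proof -
  have D: "((\<lambda>t. Y t \<bullet> Z) has_real_derivative f t \<bullet> Z) (at t)" for Z t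
  proof (rule has_oriented_integral_derivative_real)
    show "continuous_on UNIV (\<lambda>s. f s \<bullet> Z)"
      using f by (intro continuous_intros)
    show "has_oriented_integral (\<lambda>s. f s \<bullet> Z) (Y t \<bullet> Z - c \<bullet> Z) 0 t" for t
      using has_oriented_integral_linear[OF Y[of t] bounded_linear_inner_left[of Z]]
      by (simp add: inner_diff_left)
  qed
  show ?thesis
    unfolding has_vector_derivative_def has_derivative_at_alt
  proof (intro conjI allI impI)
    show "bounded_linear (\<lambda>s. s *\<^sub>R f t)"
      by (rule bounded_linear_scaleR_left)
    fix e :: real assume "0 < e"
    then obtain d where d: "d > 0" and close: "\<And>s. dist s t < d \<Longrightarrow> dist (f s) (f t) < e"
      using f by (metis UNIV_I continuous_on_iff)
    show "\<exists>d>0. \<forall>s. norm (s - t) < d \<longrightarrow> norm (Y s - Y t - (s - t) *\<^sub>R f t) \<le> e * norm (s - t)"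
    proof (intro exI[of _ d] conjI allI impI d)
      fix s :: real assume s: "norm (s - t) < d"
      define Z where "Z = Y s - Y t - (s - t) *\<^sub>R f t"
      have "norm ((Y s \<bullet> Z - s * (f t \<bullet> Z)) - (Y t \<bullet> Z - t * (f t \<bullet> Z))) \<le> (e * norm Z) * norm (s - t)"
      proof (rule field_differentiable_bound[where S = "ball t d" and f' = "\<lambda>r. (f r - f t) \<bullet> Z"])
        show "((\<lambda>r. Y r \<bullet> Z - r * (f t \<bullet> Z)) has_real_derivative (f r - f t) \<bullet> Z) (at r within ball t d)" for r
          using D[of Z r, THEN has_field_derivative_at_within]
          by (auto intro!: derivative_eq_intros simp: inner_diff_left)
        show "norm ((f r - f t) \<bullet> Z) \<le> e * norm Z" if "r \<in> ball t d" for r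
        proof -
          have "norm (f r - f t) \<le> e"
            using close[of r] that by (auto simp: dist_norm norm_minus_commute abs_minus_commute)
          then have "norm (f r - f t) * norm Z \<le> e * norm Z" by (rule mult_right_mono) simp
          then show ?thesis using Cauchy_Schwarz_ineq2[of "f r - f t" Z] by simp
        qed
      qed (use s d in \<open>auto simp: dist_norm norm_minus_commute\<close>)
      \<comment> \<open>Paired with \<open>Z\<close> itself the increment is the squared norm of
        \<open>Z\<close>, so one factor \<open>norm Z\<close> cancels from the mean value
        estimate.\<close>
      moreover have "(Y s \<bullet> Z - s * (f t \<bullet> Z)) - (Y t \<bullet> Z - t * (f t \<bullet> Z)) = norm Z * norm Z"
        unfolding power2_eq_square[symmetric] power2_norm_eq_inner
        by (subst (3) Z_def) (simp add: inner_diff_left algebra_simps)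
      ultimately have "norm Z * norm Z \<le> norm Z * (e * norm (s - t))"
        by (simp add: mult_ac)
      then show "norm (Y s - Y t - (s - t) *\<^sub>R f t) \<le> e * norm (s - t)"
        using \<open>0 < e\<close> unfolding Z_def[symmetric] by (cases "Z = 0") auto
    qed
  qed
qed

section \<open>The free flow\<close>

lemma mult_in_transverse_L2:
  assumes "f \<in> transverse_L2" "m \<in> borel_measurable borel" "\<And>k. \<bar>m k\<bar> \<le> 1"
  shows "(\<lambda>k. m k *\<^sub>R f k) \<in> transverse_L2"
  by (rule bounded_image_in_transverse_L2[where c = 1, OF assms(1)])
     (use assms in \<open>auto simp: transverse_L2_def intro: mult_left_le_one_le\<close>)

lemma cos_mult_in_transverse_L2: "f \<in> transverse_L2 \<Longrightarrow> (\<lambda>k. cos (t * norm k) *\<^sub>R f k) \<in> transverse_L2"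
  and sin_mult_in_transverse_L2: "f \<in> transverse_L2 \<Longrightarrow> (\<lambda>k. sin (t * norm k) *\<^sub>R f k) \<in> transverse_L2"
  by (auto intro: mult_in_transverse_L2)

lemma helicity1_in_transverse_L2:
  assumes "f \<in> transverse_L2"
  shows "(\<lambda>k. (k \<times> f k) /\<^sub>R norm k) \<in> transverse_L2"
proof (rule bounded_image_in_transverse_L2[where c = 1, OF assms])
  show "norm ((k \<times> f k) /\<^sub>R norm k) \<le> norm (1 *\<^sub>R f k)" for k
    using norm_cross3_le[of k "f k"] by (cases "k = 0") (auto simp: field_simps)
qed (use assms in \<open>auto simp: dot_cross_self transverse_L2_def\<close>)

lemmas transverse_L2_closed = zero_in_transverse_L2 add_in_transverse_L2 scaleR_in_transverse_L2
  cos_mult_in_transverse_L2 sin_mult_in_transverse_L2 helicity1_in_transverse_L2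

text \<open>Serves the operator identities that hold at every \<open>k\<close> and not merely almost
  everywhere: after transfer only membership of one side in \<open>transverse_L2\<close> is
  left.\<close>

lemma tfield_relI: "f \<in> transverse_L2 \<Longrightarrow> (\<And>k. f k = g k) \<Longrightarrow> tfield_rel f g"
  by (subgoal_tac "f = g") (auto simp: tfield_rel_def)

lemma tfield_rel_refl: "tfield_rel f f \<Longrightarrow> f \<in> transverse_L2"
  by (simp add: tfield_rel_def)

section \<open>Algebra and orthogonality of the free flow group\<close>

lemma linear_cos_mult: "linear (cos_mult t)"
  by (rule linearI; transfer; rule tfield_relI; (intro transverse_L2_closed tfield_rel_refl; assumption)?)
     (simp_all add: algebra_simps)

lemma linear_sin_mult: "linear (sin_mult t)"
  by (rule linearI; transfer; rule tfield_relI; (intro transverse_L2_closed tfield_rel_refl; assumption)?)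
     (simp_all add: algebra_simps)

lemma linear_helicity1: "linear helicity1"
  by (rule linearI; transfer; rule tfield_relI; (intro transverse_L2_closed tfield_rel_refl; assumption)?)
     (simp_all add: algebra_simps cross_add_right cross_mult_right)

lemma cos_mult_minus: "cos_mult (- t) f = cos_mult t f"
  by (transfer, rule tfield_relI) (auto intro!: transverse_L2_closed dest!: tfield_rel_refl)

lemma sin_mult_minus: "sin_mult (- t) f = - sin_mult t f"
  unfolding uminus_tfield_def
  by (transfer, rule tfield_relI) (intro transverse_L2_closed tfield_rel_refl, assumption, simp)

lemma cos_mult_0: "cos_mult 0 f = f"
  by (transfer, rule tfield_relI) (intro transverse_L2_closed tfield_rel_refl, assumption, simp)

lemma sin_mult_0: "sin_mult 0 f = 0"
  by (transfer, rule tfield_relI) (intro transverse_L2_closed tfield_rel_refl, assumption, simp)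

lemma cos_mult_plus: "cos_mult (s + t) f = cos_mult s (cos_mult t f) - sin_mult s (sin_mult t f)"
  unfolding minus_tfield_def
  by (transfer, rule tfield_relI)
     (intro transverse_L2_closed tfield_rel_refl, assumption+, simp add: distrib_right cos_add scaleR_diff_left)

lemma sin_mult_plus: "sin_mult (s + t) f = sin_mult s (cos_mult t f) + cos_mult s (sin_mult t f)"
  by (transfer, rule tfield_relI)
     (intro transverse_L2_closed tfield_rel_refl, assumption+, simp add: distrib_right sin_add scaleR_add_left)

lemma inner_cos_mult: "cos_mult t f \<bullet> g = f \<bullet> cos_mult t g"
  by transfer simp

lemma inner_sin_mult: "sin_mult t f \<bullet> g = f \<bullet> sin_mult t g"
  by transfer simp

lemma linear_free_flow: "linear (free_flow t)"
proof (rule linearI)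
  fix X Y :: "tfield \<times> tfield" and r :: real
  obtain q p q' p' where XY: "X = (q, p)" "Y = (q', p')" by fastforce
  show "free_flow t (X + Y) = free_flow t X + free_flow t Y"
    by (simp add: XY linear_add[OF linear_cos_mult] linear_add[OF linear_sin_mult])
  show "free_flow t (r *\<^sub>R X) = r *\<^sub>R free_flow t X"
    by (simp add: XY linear_scale[OF linear_cos_mult] linear_scale[OF linear_sin_mult] scaleR_add_right
        scaleR_diff_right)
qed

lemma free_flow_plus: "free_flow (s + t) X = free_flow s (free_flow t X)"
proof -
  obtain q p where X: "X = (q, p)" by fastforce
  show ?thesis
    by (simp add: X sin_mult_plus cos_mult_plus algebra_simps linear_add[OF linear_cos_mult]
        linear_add[OF linear_sin_mult] linear_diff[OF linear_cos_mult] linear_diff[OF linear_sin_mult])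
qed

lemma free_flow_0: "free_flow 0 X = X"
  by (cases X) (simp add: cos_mult_0 sin_mult_0)

text \<open>Both multipliers are self-adjoint, and the rotation by the angle
  \<open>t * norm k\<close> has the rotation by the opposite angle as its transpose.\<close>

lemma inner_free_flow_left: "free_flow t X \<bullet> Z = X \<bullet> free_flow (- t) Z"
  by (cases X, cases Z)
     (simp add: inner_cos_mult inner_sin_mult cos_mult_minus sin_mult_minus inner_add_left inner_add_right
       inner_diff_left inner_diff_right)

lemma inner_free_flow: "free_flow t X \<bullet> free_flow t Z = X \<bullet> Z"
  by (simp add: inner_free_flow_left free_flow_0 flip: free_flow_plus)

lemma norm_free_flow: "norm (free_flow t X) = norm X"
  by (simp add: norm_eq_sqrt_inner inner_free_flow)

lemma bounded_linear_free_flow: "bounded_linear (free_flow t)"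
  by (rule bounded_linear_intro[where K = 1])
     (simp_all only: linear_add[OF linear_free_flow] linear_scale[OF linear_free_flow] norm_free_flow
       mult_1_right order_refl)

declare free_flow.simps [simp del]

section \<open>Strong continuity of the free flow\<close>

lemma isCont_integral_mult_inner:
  fixes u :: "real \<Rightarrow> 'a \<Rightarrow> real" and f :: "'a \<Rightarrow> real"
  assumes f: "integrable M f" and u: "\<And>t. u t \<in> borel_measurable M"
    and b: "\<And>t k. \<bar>u t k\<bar> \<le> 1" and c: "\<And>t k. isCont (\<lambda>t. u t k) t"
  shows "isCont (\<lambda>t. \<integral>k. u t k * f k \<partial>M) t"
  unfolding continuous_at_sequentially o_def
\<comment> \<open>Along a sequence of times dominated convergence applies; since \<open>u\<close> is
  bounded by \<open>1\<close>, \<open>norm (f k)\<close> is a majorant.\<close>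
proof (intro allI impI integral_dominated_convergence[where w = "\<lambda>k. norm (f k)"])
  fix X :: "nat \<Rightarrow> real" assume X: "X \<longlonglongrightarrow> t"
  show "AE k in M. (\<lambda>n. u (X n) k * f k) \<longlonglongrightarrow> u t k * f k"
    using isCont_tendsto_compose[OF c X] by (auto intro!: tendsto_intros)
  show "AE k in M. norm (u (X n) k * f k) \<le> norm (f k)" for n
    using b by (auto simp: abs_mult intro!: mult_left_le_one_le)
qed (use f u in auto)

lemma isCont_inner_cos_mult: "isCont (\<lambda>t. cos_mult t f \<bullet> g) t"
  by transfer
     (auto simp: tfield_rel_def intro!: isCont_integral_mult_inner integrable_inner_transverse_L2)

lemma isCont_inner_sin_mult: "isCont (\<lambda>t. sin_mult t f \<bullet> g) t"
  by transfer
     (auto simp: tfield_rel_def intro!: isCont_integral_mult_inner integrable_inner_transverse_L2)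

lemma isCont_inner_free_flow: "isCont (\<lambda>t. free_flow t X \<bullet> Z) t"
  by (cases X, cases Z)
     (simp add: free_flow.simps inner_add_left inner_diff_left isCont_inner_cos_mult isCont_inner_sin_mult)

text \<open>For isometries weak continuity implies strong continuity: the squared distance between
  \<open>free_flow s X\<close> and \<open>free_flow t X\<close> is
  \<open>2 * (X \<bullet> X)\<close> minus twice their scalar product.\<close>

lemma isCont_free_flow: "isCont (\<lambda>t. free_flow t X) t"
proof -
  have "((\<lambda>s. X \<bullet> X + X \<bullet> X - 2 * (free_flow s X \<bullet> free_flow t X)) \<longlongrightarrow>
      X \<bullet> X + X \<bullet> X - 2 * (free_flow t X \<bullet> free_flow t X)) (at t)"
    using isCont_inner_free_flow[of t X "free_flow t X"]
    unfolding isCont_def by (rule tendsto_diff[OF tendsto_const tendsto_mult[OF tendsto_const]])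
  moreover have "X \<bullet> X + X \<bullet> X - 2 * (free_flow s X \<bullet> free_flow t X)
      = (norm (free_flow s X - free_flow t X))\<^sup>2" for s
    by (simp add: power2_norm_eq_inner inner_diff_left inner_diff_right inner_free_flow inner_commute)
  ultimately have "((\<lambda>s. (norm (free_flow s X - free_flow t X))\<^sup>2) \<longlongrightarrow> 0) (at t)"
    by (simp add: inner_free_flow)
  then have "((\<lambda>s. sqrt ((norm (free_flow s X - free_flow t X))\<^sup>2)) \<longlongrightarrow> sqrt 0) (at t)"
    by (rule tendsto_real_sqrt)
  then show ?thesis
    by (simp add: isCont_def tendsto_norm_zero_iff LIM_zero_iff)
qed

text \<open>Split \<open>G s\<close> into \<open>G s - G t\<close> and \<open>G t\<close>. The flow
  is isometric, so the first part tends to zero; strong continuity treats the fixed vector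
  \<open>G t\<close>.\<close>

lemma continuous_on_free_flow:
  assumes G: "continuous_on UNIV G"
  shows "continuous_on UNIV (\<lambda>s. free_flow (- s) (G s))"
proof (rule continuous_at_imp_continuous_on, rule ballI)
  fix t :: real
  have "isCont G t" using G by (simp add: continuous_on_eq_continuous_at)
  then have "((\<lambda>s. norm (free_flow (- s) (G s - G t))) \<longlongrightarrow> 0) (at t)"
    by (simp add: norm_free_flow isCont_def tendsto_norm_zero_iff LIM_zero_iff)
  moreover have "((\<lambda>s. free_flow (- s) (G t)) \<longlongrightarrow> free_flow (- t) (G t)) (at t)"
    by (rule isCont_tendsto_compose[OF isCont_free_flow]) (intro tendsto_intros)
  ultimately have "((\<lambda>s. free_flow (- s) (G s - G t) + free_flow (- s) (G t)) \<longlongrightarrow> 0 + free_flow (- t) (G t)) (at t)"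
    unfolding tendsto_norm_zero_iff by (rule tendsto_add)
  then show "isCont (\<lambda>s. free_flow (- s) (G s)) t"
    by (simp add: isCont_def flip: linear_add[OF linear_free_flow])
qed

section \<open>Helicity and the circular polarizations\<close>

lemma AE_nonzero: "AE k in lborel. k \<noteq> (0 :: real^3)"
  by (rule AE_lborel_singleton)

text \<open>The double cross product \<open>k \<times> (k \<times> v)\<close> is
  \<open>(k \<bullet> v) *\<^sub>R k - (k \<bullet> k) *\<^sub>R v\<close>, and transversality kills
  the first term. The point \<open>k = 0\<close>, where the division by \<open>norm k\<close>
  returns zero, is a null set.\<close>

lemma helicity1_helicity1: "helicity1 (helicity1 f) = - f"
  unfolding uminus_tfield_def
proof transfer
  fix f assume "tfield_rel f f"
  then have f: "f \<in> transverse_L2" by (simp add: tfield_rel_def)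
  then have "AE k in lborel. k \<bullet> f k = 0" by (simp add: transverse_L2_def)
  with AE_nonzero have "AE k in lborel. (k \<times> (k \<times> f k /\<^sub>R norm k)) /\<^sub>R norm k = - 1 *\<^sub>R f k"
  proof eventually_elim
    case (elim k)
    then have "inverse (norm k) * (inverse (norm k) * (norm k * norm k)) = 1"
      by (simp add: field_simps)
    then show ?case
      using elim by (simp add: Lagrange cross_mult_right dot_square_norm power2_eq_square)
  qed
  with f show "tfield_rel (\<lambda>k. (k \<times> (k \<times> f k /\<^sub>R norm k)) /\<^sub>R norm k) (\<lambda>k. - 1 *\<^sub>R f k)"
    unfolding tfield_rel_def by (intro conjI transverse_L2_closed)
qed

text \<open>Pointwise this is the antisymmetry of the triple product.\<close>

lemma inner_helicity1: "helicity1 f \<bullet> g = - (f \<bullet> helicity1 g)"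
proof transfer
  fix f g :: "real^3 \<Rightarrow> real^3"
  have "((k \<times> f k) /\<^sub>R norm k) \<bullet> g k = - (f k \<bullet> ((k \<times> g k) /\<^sub>R norm k))" for k
    using cross_triple[of k "f k" "g k"] cross_triple[of "g k" k "f k"]
    by (simp add: inner_commute cross_skew[of k "g k"])
  then show "(\<integral>k. ((k \<times> f k) /\<^sub>R norm k) \<bullet> g k \<partial>lborel)
      = - (\<integral>k. f k \<bullet> ((k \<times> g k) /\<^sub>R norm k) \<partial>lborel)"
    by simp
qed

text \<open>As J^2 = -1, the operator -J is a two-sided inverse, which determines the choice made by
  \<open>inv\<close>.\<close>

lemma inv_helicity: "inv helicity = (\<lambda>X. - helicity X)"
proof (rule inv_unique_comp)
  show "helicity \<circ> (\<lambda>X. - helicity X) = id"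
    by (auto simp: fun_eq_iff helicity1_helicity1 linear_neg[OF linear_helicity1])
  show "(\<lambda>X. - helicity X) \<circ> helicity = id"
    by (auto simp: fun_eq_iff helicity1_helicity1)
qed

text \<open>\<open>T\<close> maps \<open>X + c *\<^sub>R T X\<close> to \<open>c\<close> times
  itself, and symmetry makes the remainder orthogonal to the eigenspace. For the uniqueness required
  by \<open>THE\<close>, the difference of two candidates lies in the eigenspace and is orthogonal
  to it, hence to itself.\<close>

lemma orthogonal_proj_eigenspace:
  fixes T :: "'a::real_inner \<Rightarrow> 'a"
  assumes lin: "linear T" and sym: "\<And>X Z. T X \<bullet> Z = X \<bullet> T Z" and inv: "\<And>X. T (T X) = X"
    and c: "c * c = 1"
  shows "orthogonal_proj (eigenspace T c) X = (1/2) *\<^sub>R (X + c *\<^sub>R T X)"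
  unfolding orthogonal_proj_def
proof (rule the_equality)
  let ?Y = "(1/2) *\<^sub>R (X + c *\<^sub>R T X)"
  have Y: "?Y \<in> eigenspace T c"
    using c by (simp add: eigenspace_def linear_scale[OF lin] linear_add[OF lin] inv scaleR_add_right)
  have orth: "(X - ?Y) \<bullet> Z = 0" if "Z \<in> eigenspace T c" for Z
  proof -
    have "T X \<bullet> Z = c * (X \<bullet> Z)" using that by (simp add: sym eigenspace_def)
    then have "(X - ?Y) \<bullet> Z = X \<bullet> Z - (1/2) * (X \<bullet> Z + (c * c) * (X \<bullet> Z))"
      by (simp add: inner_diff_left inner_add_left)
    then show ?thesis using c by simp
  qed
  show "?Y \<in> eigenspace T c \<and> (\<forall>Z\<in>eigenspace T c. (X - ?Y) \<bullet> Z = 0)"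
    using Y orth by blast
  fix Y' assume Y': "Y' \<in> eigenspace T c \<and> (\<forall>Z\<in>eigenspace T c. (X - Y') \<bullet> Z = 0)"
  have "Y' - ?Y \<in> eigenspace T c"
    using Y Y' unfolding eigenspace_def by (auto simp: linear_diff[OF lin] scaleR_diff_right)
  then have "(X - ?Y) \<bullet> (Y' - ?Y) - (X - Y') \<bullet> (Y' - ?Y) = 0"
    using Y' orth by auto
  then have "(Y' - ?Y) \<bullet> (Y' - ?Y) = 0"
    by (simp flip: inner_diff_left)
  then show "Y' = ?Y" by simp
qed

text \<open>The projections are (1 + T)/2 and (1 - T)/2, so the difference is -T, and J^-1 = -J
  turns this into J F. Antisymmetry of \<open>helicity1\<close> gives the symmetry of T, and J^2 =
  -1 gives T^2 = 1.\<close>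

lemma Pi_minus_diff_Pi_plus: "Pi_minus X - Pi_plus X = helicity (symplectic_map X)"
proof -
  let ?T = "inv helicity \<circ> symplectic_map"
  have T: "?T (q, p) = (helicity1 p, - helicity1 q)" for q p
    by (simp add: inv_helicity linear_neg[OF linear_helicity1])
  have lin: "linear ?T"
  proof (rule linearI)
    fix X Y :: "tfield \<times> tfield" and r :: real
    obtain q p q' p' where XY: "X = (q, p)" "Y = (q', p')" by fastforce
    show "?T (X + Y) = ?T X + ?T Y"
      unfolding XY add_Pair T by (simp add: linear_add[OF linear_helicity1])
    show "?T (r *\<^sub>R X) = r *\<^sub>R ?T X"
      unfolding XY scaleR_Pair T by (simp add: linear_scale[OF linear_helicity1])
  qed
  have sym: "?T X \<bullet> Z = X \<bullet> ?T Z" for X Z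
  proof -
    obtain q p q' p' where XZ: "X = (q, p)" "Z = (q', p')" by fastforce
    show ?thesis
      unfolding XZ T by (simp add: inner_helicity1)
  qed
  have inv: "?T (?T X) = X" for X
  proof -
    obtain q p where X: "X = (q, p)" by fastforce
    show ?thesis
      unfolding X T by (simp add: helicity1_helicity1 linear_neg[OF linear_helicity1])
  qed
  have "Pi_minus X - Pi_plus X = - ((1/2) *\<^sub>R ?T X + (1/2) *\<^sub>R ?T X)"
    unfolding Pi_minus_def Pi_plus_def
    by (subst (1 2) orthogonal_proj_eigenspace[OF lin sym inv])
       (simp_all add: scaleR_add_right scaleR_diff_right)
  also have "\<dots> = - ?T X"
    by (simp only: flip: scaleR_add_left) simp
  finally have "Pi_minus X - Pi_plus X = - ?T X" .
  then show ?thesis by (simp add: inv_helicity)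
qed

lemma helicity_helicity: "helicity (helicity X) = - X"
  by (cases X) (simp add: helicity1_helicity1)

text \<open>The minus sign in the definition of E cancels against J^2 = -1. What remains is the
  expression produced by differentiating the squared norm of a solution.\<close>

lemma E_field_Pi_diff:
  "E_field chi m x (Pi_minus X) - E_field chi m x (Pi_plus X) = B_field chi m x (symplectic_map X)"
proof -
  have hel: "helicity (X - Y) = helicity X - helicity Y" for X Y
    by (cases X, cases Y) (simp add: linear_diff[OF linear_helicity1])
  have B: "B_field chi m x (X - Y) = B_field chi m x X - B_field chi m x Y" for X Y
    by (cases X, cases Y) (simp add: inner_diff_right)
  have "E_field chi m x (Pi_minus X) - E_field chi m x (Pi_plus X)
      = - B_field chi m x (helicity (Pi_minus X - Pi_plus X))"
    by (simp add: E_field_def hel B)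
  \<comment> \<open>The negation is written as a difference to fit the linearity fact
    \<open>B\<close>.\<close>
  also have "\<dots> = - B_field chi m x (0 - symplectic_map X)"
    by (simp add: Pi_minus_diff_Pi_plus helicity_helicity)
  also have "\<dots> = B_field chi m x (symplectic_map X)"
    unfolding B by (simp add: zero_prod_def)
  finally show ?thesis .
qed

unbundle no cross3_syntax

section \<open>Hilbert--Schmidt geometry of complex matrices\<close>

lemma matrix_diff_ldistrib: "A ** (B - C) = A ** B - A ** (C :: complex^'n^'m)"
  by (simp add: matrix_matrix_mult_def vec_eq_iff sum_subtractf right_diff_distrib)

lemma matrix_diff_rdistrib: "(A - B) ** C = A ** C - B ** (C :: complex^'n^'m)"
  by (simp add: matrix_matrix_mult_def vec_eq_iff sum_subtractf left_diff_distrib)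

lemma matrix_add_rdistrib: "(A + B) ** C = A ** C + B ** (C :: complex^'n^'m)"
  by (simp add: matrix_matrix_mult_def vec_eq_iff sum.distrib distrib_right)

lemma matrix_mult_minus:
  fixes M :: "complex^'n^'m"
  shows "(- M) ** N = - (M ** N)" "M ** (- N) = - (M ** N)"
  by (simp_all add: matrix_matrix_mult_def vec_eq_iff sum_negf)

lemma mat_mult_eq: "mat c ** (M :: complex^'n^'n) = (\<chi> i j. c * M $ i $ j)"
  by (simp add: matrix_matrix_mult_def mat_def vec_eq_iff if_distrib[of "\<lambda>x. x * _"] cong: if_cong)

lemma mult_mat_eq: "(M :: complex^'n^'n) ** mat c = (\<chi> i j. c * M $ i $ j)"
  by (simp add: matrix_matrix_mult_def mat_def vec_eq_iff if_distrib[of "\<lambda>x. _ * x"] mult.commute cong: if_cong)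

lemma mat_minus: "mat (- c) = - (mat c :: complex^'n^'n)"
  by (simp add: mat_def vec_eq_iff)

lemma bounded_bilinear_matrix_mult: "bounded_bilinear ((**) :: complex^'n^'n \<Rightarrow> complex^'n^'n \<Rightarrow> complex^'n^'n)"
  unfolding bilinear_conv_bounded_bilinear[symmetric] bilinear_def
  by (auto intro!: linearI simp: matrix_matrix_mult_def vec_eq_iff sum.distrib distrib_left distrib_right
      scaleR_sum_right)

lemma conj_transpose_simps:
  "conj_transpose (A + B) = conj_transpose A + conj_transpose B"
  "conj_transpose (A - B) = conj_transpose A - conj_transpose B"
  "conj_transpose (- A) = - conj_transpose A"
  "conj_transpose (r *\<^sub>R A) = r *\<^sub>R conj_transpose A"
  "conj_transpose (mat c) = mat (cnj c)"
  "conj_transpose (conj_transpose A) = A"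
  by (auto simp: conj_transpose_def vec_eq_iff mat_def)

lemma trace_simps:
  "trace (mat c :: complex^'m^'m) = of_nat CARD('m) * c"
  "trace (conj_transpose A) = cnj (trace A)"
  "trace (- A) = - trace (A :: complex^'m^'m)"
  "trace (r *\<^sub>R A) = r *\<^sub>R trace (A :: complex^'m^'m)"
  "trace (mat c ** A) = c * trace (A :: complex^'m^'m)"
proof -
  show "trace (mat c ** A) = c * trace (A :: complex^'m^'m)"
    by (simp add: trace_def mat_mult_eq sum_distrib_left)
qed (simp_all add: trace_def mat_def conj_transpose_def scaleR_sum_right sum_negf)

text \<open>Identifies the Euclidean scalar product of matrix entries with the real Hilbert--Schmidt
  product, so that adjoints of multiplications can be read off from cyclicity of the trace.\<close>

lemma inner_matrix_eq_trace: "M \<bullet> N = Re (trace (M ** conj_transpose N))" for M N :: "complex^'m^'m"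
  by (simp add: inner_vec_def trace_def matrix_matrix_mult_def conj_transpose_def inner_complex_def)

lemma inner_mult_left_matrix: "M \<bullet> (A ** N) = (conj_transpose A ** M) \<bullet> N" for M N A :: "complex^'m^'m"
  unfolding inner_matrix_eq_trace conj_transpose_mult
  by (metis matrix_mul_assoc trace_mul_sym)

lemma inner_mult_right_matrix: "M \<bullet> (N ** A) = (M ** conj_transpose A) \<bullet> N" for M N A :: "complex^'m^'m"
  unfolding inner_matrix_eq_trace conj_transpose_mult
  by (metis matrix_mul_assoc)

lemma inner_conj_transpose: "conj_transpose M \<bullet> N = M \<bullet> conj_transpose N" for M N :: "complex^'m^'m"
proof -
  have "trace (conj_transpose M ** conj_transpose N) = cnj (trace (N ** M))"
    unfolding conj_transpose_mult[symmetric] by (rule trace_simps)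
  then show ?thesis
    by (simp add: inner_matrix_eq_trace conj_transpose_simps trace_mul_sym[of N])
qed

text \<open>The rank-one operator |a><a|, for a unit vector the orthogonal projection onto its
  line.\<close>

definition outer :: "complex^'m \<Rightarrow> complex^'m^'m" where
  "outer a = (\<chi> i j. a $ i * cnj (a $ j))"

lemma trace_mult_outer: "trace (Y ** outer a) = (\<Sum>i\<in>UNIV. (Y *v a) $ i * cnj (a $ i))"
  by (simp add: trace_def outer_def matrix_matrix_mult_def matrix_vector_mult_def sum_distrib_right mult.assoc)

lemma conj_transpose_outer: "conj_transpose (outer a) = outer a"
  by (simp add: conj_transpose_def outer_def vec_eq_iff mult.commute)

lemma matrix_mult_outer: "M ** outer a = (\<chi> i j. (M *v a) $ i * cnj (a $ j))"
  by (simp add: outer_def matrix_matrix_mult_def matrix_vector_mult_def vec_eq_iff sum_distrib_right mult.assoc)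

lemma outer_mult_vec: "outer a *v b = (\<chi> i. a $ i * (\<Sum>j\<in>UNIV. b $ j * cnj (a $ j)))"
  by (simp add: outer_def matrix_vector_mult_def vec_eq_iff sum_distrib_left mult_ac)

lemma outer_idem:
  assumes "(\<Sum>i\<in>UNIV. a $ i * cnj (a $ i)) = 1"
  shows "outer a ** outer a = outer a"
  unfolding matrix_mult_outer outer_mult_vec assms by (simp add: outer_def)

text \<open>Choose a unit vector \<open>a\<close> in the range of \<open>R\<close>. Then
  \<open>R - outer a\<close> is again a Hermitian idempotent, so its squared Hilbert--Schmidt norm
  equals its trace, which is 1 - 1 = 0.\<close>

lemma projection_trace_one_eq_outer:
  fixes R :: "complex^'m^'m"
  assumes herm: "conj_transpose R = R" and idem: "R ** R = R" and tr: "trace R = 1"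
  obtains a where "(\<Sum>i\<in>UNIV. a $ i * cnj (a $ i)) = 1" "R = outer a"
proof -
  \<comment> \<open>A nonzero diagonal entry yields a nonzero column of \<open>R\<close>, and
    idempotence makes every column a fixed vector.\<close>
  have "\<exists>i. R $ i $ i \<noteq> 0"
    by (rule ccontr) (use tr in \<open>simp add: trace_def\<close>)
  then obtain i where i: "R $ i $ i \<noteq> 0" ..
  define v where "v = R *v axis i 1"
  have vi: "v $ i = R $ i $ i"
    by (simp add: v_def matrix_vector_mult_def axis_def if_distrib cong: if_cong)
  have Rv: "R *v v = v"
    by (simp add: v_def matrix_vector_mul_assoc idem)
  define a where "a = (1 / norm v) *\<^sub>R v"
  have "v \<noteq> 0" using vi i by auto
  then have "norm a = 1" by (simp add: a_def)
  then have "(norm a)\<^sup>2 = 1" by simp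
  then have "(\<Sum>i\<in>UNIV. (norm (a $ i))\<^sup>2) = 1"
    by (simp add: norm_vec_def L2_set_def sum_nonneg)
  then have unit: "(\<Sum>i\<in>UNIV. a $ i * cnj (a $ i)) = 1"
    unfolding complex_norm_square[symmetric] of_real_sum[symmetric] by (simp only: of_real_1)
  have "R *v (r *\<^sub>R v) = r *\<^sub>R (R *v v)" for r
    by (simp add: matrix_vector_mult_def vec_eq_iff scaleR_sum_right)
  then have Ra: "R *v a = a"
    by (simp add: a_def Rv)
  define D where "D = R - outer a"
  have RP: "R ** outer a = outer a"
    unfolding matrix_mult_outer Ra by (simp add: outer_def)
  have PR: "outer a ** R = outer a"
    using arg_cong[OF RP, of conj_transpose] by (simp add: conj_transpose_mult conj_transpose_outer herm)
  have PP: "outer a ** outer a = outer a"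
    using unit by (rule outer_idem)
  have "D ** conj_transpose D = D"
    by (simp add: D_def conj_transpose_simps conj_transpose_outer herm matrix_diff_ldistrib
        matrix_diff_rdistrib RP PR PP idem)
  moreover have "trace D = 0"
    using unit by (simp add: D_def trace_sub tr) (simp add: outer_def trace_def)
  ultimately have "D \<bullet> D = 0"
    by (simp add: inner_matrix_eq_trace)
  then have "R = outer a" by (simp add: D_def)
  with unit show thesis by (rule that)
qed

section \<open>Matrix representation of the dual of the Lie algebra\<close>

text \<open>The Hilbert--Schmidt orthogonal projection onto the Lie algebra: the antihermitian part
  has trace \<open>\<i> * Im (trace M)\<close>, which a scalar matrix removes.\<close>

definition su_part :: "'n::finite spin_matrix \<Rightarrow> 'n spin_matrix" where
  "su_part M = (1/2) *\<^sub>R (M - conj_transpose M) - mat (\<i> * Im (trace M) / of_nat CARD('n \<Rightarrow> 2))"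

lemma su_part_in_su:
  fixes M :: "'n::finite spin_matrix"
  shows "trace (su_part M) = 0 \<and> conj_transpose (su_part M) = - su_part M"
proof
  have "trace M - cnj (trace M) = 2 * (\<i> * Im (trace M))"
    by (simp add: complex_eq_iff)
  then show "trace (su_part M) = 0"
    unfolding su_part_def trace_sub trace_simps
    by (simp del: of_nat_power card_fun) 
  show "conj_transpose (su_part M) = - su_part M"
    by (simp add: su_part_def conj_transpose_simps mat_minus scaleR_diff_right del: of_nat_power card_fun)
qed

lemma linear_su_part: "linear su_part"
  by (rule linearI)
     (simp_all add: su_part_def conj_transpose_simps trace_add trace_simps mat_def vec_eq_iff algebra_simps
       add_divide_distrib scaleR_conv_of_real[where 'a = complex])

lemma su_part_su_matrix: "su_part (su_matrix Y) = su_matrix Y"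
  using su_matrix[of Y] by (simp add: su_part_def flip: scaleR_add_left)

text \<open>An antihermitian matrix is orthogonal to Hermitian ones, and a traceless one to scalar
  matrices; \<open>su_part\<close> discards only such terms.\<close>

lemma inner_su_part:
  assumes "trace W = 0" "conj_transpose W = - W"
  shows "W \<bullet> su_part M = W \<bullet> M"
proof -
  have "W \<bullet> conj_transpose M = - (W \<bullet> M)"
    using assms by (simp flip: inner_conj_transpose)
  moreover have "W \<bullet> mat c = 0" for c
  proof -
    have "W ** conj_transpose (mat c) = mat (cnj c) ** W"
      by (simp add: conj_transpose_simps mult_mat_eq mat_mult_eq)
    then show ?thesis by (simp add: inner_matrix_eq_trace trace_simps assms)
  qed
  ultimately show ?thesis
    by (simp add: su_part_def inner_diff_right)
qed

text \<open>The Riesz representative of \<open>\<omega>\<close> for the real scalar product \<open>Re tr (M N\<^sup>*)\<close>.\<close>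

definition rep :: "('n::finite su \<Rightarrow>\<^sub>L real) \<Rightarrow> 'n spin_matrix" where
  "rep \<omega> = (\<Sum>b\<in>Basis. blinfun_apply \<omega> (Abs_su (su_part b)) *\<^sub>R b)"

lemma su_matrix_Abs_su_part: "su_matrix (Abs_su (su_part M)) = su_part M"
  using su_part_in_su[of M] by (simp add: Abs_su_inverse)

lemma linear_Abs_su_part: "linear (\<lambda>M. Abs_su (su_part M))"
proof (rule linearI)
  fix M N :: "'a spin_matrix" and r :: real
  show "Abs_su (su_part (M + N)) = Abs_su (su_part M) + Abs_su (su_part N)"
    by (simp add: plus_su.rep_eq su_matrix_Abs_su_part
        flip: su_matrix_inject linear_add[OF linear_su_part])
  show "Abs_su (su_part (r *\<^sub>R M)) = r *\<^sub>R Abs_su (su_part M)"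
    by (simp add: scaleR_su.rep_eq su_matrix_Abs_su_part
        flip: su_matrix_inject linear_scale[OF linear_su_part])
qed

lemma inner_rep: "rep \<omega> \<bullet> M = blinfun_apply \<omega> (Abs_su (su_part M))"
proof -
  have lin: "linear (\<lambda>M. blinfun_apply \<omega> (Abs_su (su_part M)))"
    using linear_compose[OF linear_Abs_su_part, of "blinfun_apply \<omega>"]
    by (simp add: o_def bounded_linear.linear blinfun.bounded_linear_right)
  have "rep \<omega> \<bullet> M = (\<Sum>b\<in>Basis. (M \<bullet> b) *\<^sub>R blinfun_apply \<omega> (Abs_su (su_part b)))"
    by (simp add: rep_def inner_sum_left inner_commute[of M] mult.commute)
  also have "\<dots> = blinfun_apply \<omega> (Abs_su (su_part (\<Sum>b\<in>Basis. (M \<bullet> b) *\<^sub>R b)))"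
    by (simp only: linear_sum[OF lin] linear_scale[OF lin])
  finally show ?thesis by (simp add: euclidean_representation)
qed

lemma inner_rep_su_matrix: "rep \<omega> \<bullet> su_matrix Y = blinfun_apply \<omega> Y"
  by (simp add: inner_rep su_part_su_matrix su_matrix_inverse)

text \<open>Uniqueness of the Riesz representative: an element of the Lie algebra is determined by
  its scalar products with the Lie algebra.\<close>

lemma rep_eqI:
  assumes "trace W = 0" "conj_transpose W = - W" "\<And>Y. W \<bullet> su_matrix Y = blinfun_apply \<omega> Y"
  shows "rep \<omega> = W"
proof -
  have "rep \<omega> \<bullet> M = W \<bullet> M" for M
  proof -
    have "rep \<omega> \<bullet> M = W \<bullet> su_matrix (Abs_su (su_part M))"
      by (simp add: inner_rep assms(3))
    then show ?thesis by (simp add: su_matrix_Abs_su_part inner_su_part assms)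
  qed
  then show ?thesis by (intro vector_eq_rdot[THEN iffD1]) blast
qed

lemma mat_su_part: "su_part (mat c :: 'n::finite spin_matrix) = 0"
proof -
  have "(1/2) *\<^sub>R (mat c - mat (cnj c)) = (mat (\<i> * Im c) :: 'n spin_matrix)"
    by (simp add: mat_def vec_eq_iff complex_eq_iff)
  then show ?thesis
    by (simp add: su_part_def conj_transpose_simps trace_simps del: of_nat_power card_fun)
qed

text \<open>\<open>rep\<close> is orthogonal to whatever \<open>su_part\<close> annihilates. Scalar
  matrices force trace zero; the sign change of \<open>su_part\<close> under conjugate transposition
  forces antihermiticity.\<close>

lemma rep_in_su: "trace (rep \<omega>) = 0" "conj_transpose (rep \<omega>) = - rep \<omega>"
proof -
  have 0: "rep \<omega> \<bullet> mat c = 0" for c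
    by (simp add: inner_rep mat_su_part flip: zero_su_def)
  have "Re (cnj c * trace (rep \<omega>)) = 0" for c
    using 0[of c] by (simp add: inner_matrix_eq_trace conj_transpose_simps mult_mat_eq flip: mat_mult_eq)
       (simp add: trace_simps)
  from this[of 1] this[of \<i>] show "trace (rep \<omega>) = 0"
    by (simp add: complex_eq_iff)
  have "su_part (conj_transpose M) = - su_part M" for M :: "'a spin_matrix"
    by (simp add: su_part_def conj_transpose_simps trace_simps mat_minus scaleR_diff_right del: of_nat_power card_fun)
  then have "rep \<omega> \<bullet> conj_transpose M = rep \<omega> \<bullet> (- M)" for M
    unfolding inner_rep linear_neg[OF linear_su_part] by simp
  then have "conj_transpose (rep \<omega>) \<bullet> M = - rep \<omega> \<bullet> M" for M
    by (simp add: inner_conj_transpose)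
  then show "conj_transpose (rep \<omega>) = - rep \<omega>"
    by (intro vector_eq_rdot[THEN iffD1]) blast
qed

text \<open>The density matrix: \<open>\<langle>\<omega>, Y\<rangle> = -i tr (Y \<rho>)\<close> with \<open>tr \<rho> = 1\<close>.\<close>

definition dens :: "('n::finite su \<Rightarrow>\<^sub>L real) \<Rightarrow> 'n spin_matrix" where
  "dens \<omega> = mat (1 / of_nat CARD('n \<Rightarrow> 2)) - mat \<i> ** rep \<omega>"

lemma mat_i_mat_i: "mat \<i> ** (mat \<i> ** M) = - (M :: complex^'n^'n)"
  by (simp add: mat_mult_eq vec_eq_iff flip: mult.assoc)

lemma mat_mult_commute: "(M :: complex^'n^'n) ** mat c = mat c ** M"
  by (simp add: mat_mult_eq mult_mat_eq)

text \<open>Tracelessness of \<open>Y\<close> hides the shift by \<open>mat c\<close>. Since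
  \<open>Y\<close> is antihermitian, the trace on the right is purely imaginary, so the real scalar
  product captures all of it.\<close>

lemma outer_pairing:
  fixes Y :: "'n::finite spin_matrix"
  assumes Y: "trace Y = 0" "conj_transpose Y = - Y"
  shows "complex_of_real ((mat \<i> ** (outer a - mat c)) \<bullet> Y) = inverse \<i> * trace (Y ** outer a)"
proof -
  have "conj_transpose (Y ** outer a) = - (outer a ** Y)"
    by (simp add: conj_transpose_mult conj_transpose_outer Y matrix_mult_minus)
  then have "cnj (trace (Y ** outer a)) = - trace (Y ** outer a)"
    using trace_simps(2)[of "Y ** outer a"] by (simp add: trace_simps(3) trace_mul_sym[of Y])
  then have re: "Re (trace (Y ** outer a)) = 0"
    by (simp add: complex_eq_iff)
  have "(mat \<i> ** (outer a - mat c)) ** conj_transpose Y = - (mat \<i> ** (outer a ** Y - mat c ** Y))"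
    by (simp add: Y matrix_diff_rdistrib matrix_mult_minus matrix_mul_assoc[symmetric])
  then have "trace ((mat \<i> ** (outer a - mat c)) ** conj_transpose Y) = - \<i> * trace (Y ** outer a)"
    by (simp add: trace_simps trace_sub Y trace_mul_sym[of Y])
  with re show ?thesis
    by (simp add: inner_matrix_eq_trace complex_eq_iff)
qed

text \<open>\<open>dens \<omega>\<close> is always Hermitian of trace one, so it is idempotent
  exactly when it projects onto a line; a unit vector of that line defines the form.\<close>

lemma Omega_iff_dens_idem:
  fixes \<omega> :: "'n::finite su \<Rightarrow>\<^sub>L real"
  shows "\<omega> \<in> Omega \<longleftrightarrow> dens \<omega> ** dens \<omega> = dens \<omega>"
proof
  \<comment> \<open>This value makes \<open>outer a - mat ?c\<close> traceless, as
    \<open>outer a\<close> has trace one.\<close>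
  let ?c = "1 / of_nat CARD('n \<Rightarrow> 2) :: complex"
  {
    assume "\<omega> \<in> Omega"
    then obtain a where unit: "(\<Sum>i\<in>UNIV. a $ i * cnj (a $ i)) = 1"
      and a: "\<And>Y. complex_of_real (blinfun_apply \<omega> Y) = inverse \<i> * trace (su_matrix Y ** outer a)"
      unfolding Omega_def hermitian_inner_def trace_mult_outer by blast
    have "rep \<omega> = mat \<i> ** (outer a - mat ?c)"
    proof (rule rep_eqI)
      have "trace (outer a) = 1" using unit by (simp add: outer_def trace_def)
      then show "trace (mat \<i> ** (outer a - mat ?c)) = 0"
        by (simp add: trace_simps trace_sub del: of_nat_power card_fun)
      have "conj_transpose (mat \<i> ** (outer a - mat ?c)) = mat (- \<i>) ** (outer a - mat ?c)"
        by (simp add: conj_transpose_mult conj_transpose_simps conj_transpose_outer mat_mult_commute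
             del: of_nat_power card_fun)
      then show "conj_transpose (mat \<i> ** (outer a - mat ?c)) = - (mat \<i> ** (outer a - mat ?c))"
        by (simp add: mat_mult_eq vec_eq_iff)
      show "(mat \<i> ** (outer a - mat ?c)) \<bullet> su_matrix Y = blinfun_apply \<omega> Y" for Y
        using outer_pairing[of "su_matrix Y" a ?c] su_matrix[of Y]
        unfolding a[symmetric] by (simp del: of_nat_power card_fun)
    qed
    then have "dens \<omega> = outer a"
      by (simp add: dens_def mat_i_mat_i del: of_nat_power card_fun)
    moreover have "outer a ** outer a = outer a"
      using unit by (rule outer_idem)
    ultimately show "dens \<omega> ** dens \<omega> = dens \<omega>" by simp
  }
  assume idem: "dens \<omega> ** dens \<omega> = dens \<omega>"
  have "trace (dens \<omega>) = 1"
    by (simp add: dens_def trace_simps trace_sub rep_in_su del: of_nat_power card_fun)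
  moreover have "conj_transpose (dens \<omega>) = mat ?c - mat \<i> ** rep \<omega>"
  proof -
    have "conj_transpose (mat \<i> ** rep \<omega>) = mat \<i> ** rep \<omega>"
      by (simp add: conj_transpose_mult conj_transpose_simps rep_in_su)
         (simp add: mult_mat_eq mat_mult_eq vec_eq_iff)
    then show ?thesis by (simp add: dens_def conj_transpose_simps del: of_nat_power card_fun)
  qed
  ultimately obtain a where unit: "(\<Sum>i\<in>UNIV. a $ i * cnj (a $ i)) = 1" and a: "dens \<omega> = outer a"
    using projection_trace_one_eq_outer[OF _ idem] by (auto simp: dens_def)
  have "rep \<omega> = mat \<i> ** (outer a - mat ?c)"
    unfolding a[symmetric] dens_def by (simp add: mat_mult_eq vec_eq_iff flip: mult.assoc del: of_nat_power card_fun)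
  then have "complex_of_real (blinfun_apply \<omega> Y) = inverse \<i> * trace (su_matrix Y ** outer a)" for Y
    using outer_pairing[of "su_matrix Y" a ?c] su_matrix[of Y]
    by (simp flip: inner_rep_su_matrix del: of_nat_power card_fun)
  with unit show "\<omega> \<in> Omega"
    unfolding Omega_def hermitian_inner_def trace_mult_outer by blast
qed

section \<open>Invariance of the coadjoint orbit\<close>

lemma linear_lie_bracket_left: "linear (\<lambda>A. lie_bracket A B)"
  by (rule linearI; transfer)
     (simp_all add: matrix_add_ldistrib matrix_add_rdistrib matrix_matrix_mult_def vec_eq_iff scaleR_sum_right
       algebra_simps sum.distrib)

text \<open>The bracket moves from the test matrix to the representative: for antihermitian A,
  multiplication by A is skew for the Hilbert--Schmidt product on either side.\<close>

lemma rep_has_vector_derivative: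
  fixes \<omega> :: "real \<Rightarrow> ('n::finite su \<Rightarrow>\<^sub>L real)" and G :: "'n su"
  assumes "\<And>Y. ((\<lambda>t. blinfun_apply (\<omega> t) Y) has_real_derivative blinfun_apply (\<omega> t) (lie_bracket G Y)) (at t)"
  shows "((\<lambda>t. rep (\<omega> t)) has_vector_derivative
    rep (\<omega> t) ** su_matrix G - su_matrix G ** rep (\<omega> t)) (at t)"
proof -
  define A where "A = su_matrix G"
  define V where "V = rep (\<omega> t) ** A - A ** rep (\<omega> t)"
  have A: "conj_transpose A = - A"
    using su_matrix[of G] by (simp add: A_def)
  have V: "trace V = 0" "conj_transpose V = - V"
    by (simp_all add: V_def trace_sub trace_mul_sym[of A] conj_transpose_simps conj_transpose_mult A rep_in_su matrix_mult_minus)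
  have "blinfun_apply (\<omega> t) (lie_bracket G (Abs_su (su_part b))) = V \<bullet> b" for b
  proof -
    have "blinfun_apply (\<omega> t) (lie_bracket G (Abs_su (su_part b)))
        = rep (\<omega> t) \<bullet> (A ** su_part b - su_part b ** A)"
      by (simp add: lie_bracket.rep_eq su_matrix_Abs_su_part A_def flip: inner_rep_su_matrix)
    also have "\<dots> = V \<bullet> su_part b"
      using inner_mult_left_matrix[of "rep (\<omega> t)" A "su_part b"]
        inner_mult_right_matrix[of "rep (\<omega> t)" "su_part b" A]
      by (simp add: inner_diff_right A matrix_mult_minus V_def inner_diff_left)
    also have "\<dots> = V \<bullet> b"
      using V by (rule inner_su_part)
    finally show ?thesis .
  qed
  then have "(\<Sum>b\<in>Basis. blinfun_apply (\<omega> t) (lie_bracket G (Abs_su (su_part b))) *\<^sub>R b) = V"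
    by (simp add: euclidean_representation)
  moreover have "((\<lambda>t. rep (\<omega> t)) has_vector_derivative
      (\<Sum>b\<in>Basis. blinfun_apply (\<omega> t) (lie_bracket G (Abs_su (su_part b))) *\<^sub>R b)) (at t)"
    unfolding rep_def
    by (intro has_vector_derivative_sum)
       (use assms has_vector_derivative_scaleR[OF _ has_vector_derivative_const] in fastforce)
  ultimately show ?thesis by (simp add: V_def A_def)
qed

lemma coadjoint_flow_preserves_Omega:
  fixes \<omega> :: "real \<Rightarrow> ('n::finite su \<Rightarrow>\<^sub>L real)" and G :: "real \<Rightarrow> 'n su"
  assumes ode: "\<And>t Y. ((\<lambda>t. blinfun_apply (\<omega> t) Y) has_real_derivative
      blinfun_apply (\<omega> t) (lie_bracket (G t) Y)) (at t)"
    and init: "\<omega> 0 \<in> Omega"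
  shows "\<omega> t \<in> Omega"
proof -
  define D where "D = (\<lambda>t. dens (\<omega> t) ** dens (\<omega> t) - dens (\<omega> t))"
  have "((\<lambda>t. D t \<bullet> D t) has_real_derivative 0) (at t)" for t
  proof -
    define A where "A = su_matrix (G t)"
    have A: "conj_transpose A = - A"
      using su_matrix[of "G t"] by (simp add: A_def)
    let ?\<rho> = "dens (\<omega> t)"
    have "((\<lambda>t. dens (\<omega> t)) has_vector_derivative
        0 - mat \<i> ** (rep (\<omega> t) ** A - A ** rep (\<omega> t))) (at t)"
      unfolding dens_def A_def
      by (intro has_vector_derivative_diff has_vector_derivative_const rep_has_vector_derivative ode
          bounded_linear.has_vector_derivative[OF bounded_bilinear.bounded_linear_right[OF bounded_bilinear_matrix_mult]])
    \<comment> \<open>The scalar part of the density matrix commutes with \<open>A\<close>, so it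
      may be inserted in the commutator.\<close>
    moreover have "0 - mat \<i> ** (rep (\<omega> t) ** A - A ** rep (\<omega> t)) = ?\<rho> ** A - A ** ?\<rho>"
      by (simp add: dens_def matrix_diff_ldistrib matrix_diff_rdistrib matrix_mul_assoc mat_mult_commute
           del: of_nat_power card_fun)
    ultimately have \<rho>': "((\<lambda>t. dens (\<omega> t)) has_vector_derivative ?\<rho> ** A - A ** ?\<rho>) (at t)"
      by simp
    have "(D has_vector_derivative
        (?\<rho> ** (?\<rho> ** A - A ** ?\<rho>) + (?\<rho> ** A - A ** ?\<rho>) ** ?\<rho>) - (?\<rho> ** A - A ** ?\<rho>)) (at t)"
      unfolding D_def
      by (intro has_vector_derivative_diff bounded_bilinear.has_vector_derivative[OF bounded_bilinear_matrix_mult] \<rho>')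
    \<comment> \<open>Commutation with \<open>A\<close> is a derivation, so the square obeys the
      same equation.\<close>
    moreover have "(?\<rho> ** (?\<rho> ** A - A ** ?\<rho>) + (?\<rho> ** A - A ** ?\<rho>) ** ?\<rho>) - (?\<rho> ** A - A ** ?\<rho>)
        = D t ** A - A ** D t"
      by (simp add: D_def matrix_diff_ldistrib matrix_diff_rdistrib matrix_mul_assoc)
    ultimately have D': "(D has_vector_derivative D t ** A - A ** D t) (at t)"
      by simp
    have "((\<lambda>t. D t \<bullet> D t) has_vector_derivative D t \<bullet> (D t ** A - A ** D t) + (D t ** A - A ** D t) \<bullet> D t) (at t)"
      by (intro bounded_bilinear.has_vector_derivative[OF bounded_bilinear_inner] D')
    \<comment> \<open>By skewness each product equals its own negative.\<close>
    moreover have "D t \<bullet> (D t ** A) = 0" "D t \<bullet> (A ** D t) = 0"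
      using inner_mult_right_matrix[of "D t" "D t" A] inner_mult_left_matrix[of "D t" A "D t"]
      by (simp_all add: A matrix_mult_minus inner_commute)
    ultimately show ?thesis
      by (simp add: has_real_derivative_iff_has_vector_derivative inner_diff_right inner_diff_left inner_commute)
  qed
  then have "D t \<bullet> D t = D 0 \<bullet> D 0"
    using DERIV_isconst_all by blast
  moreover have "D 0 = 0"
    using init by (simp add: Omega_iff_dens_idem D_def)
  ultimately have "D t = 0" by simp
  then show ?thesis by (simp add: Omega_iff_dens_idem D_def)
qed

section \<open>Weak solutions\<close>

context
  fixes chi :: "real \<Rightarrow> real" and h :: real and \<beta> :: "real^3" and x :: "'n::finite \<Rightarrow> real^3"
    and q p :: "real \<Rightarrow> tfield" and \<omega> :: "real \<Rightarrow> ('n su \<Rightarrow>\<^sub>L real)"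
  assumes ws: "weak_solution chi h \<beta> x q p \<omega>"
begin

lemma weak_solution_continuous:
  shows "continuous_on UNIV q" "continuous_on UNIV p" "continuous_on UNIV \<omega>"
proof -
  have c: "continuous_on UNIV (\<lambda>t. ((q t, p t), \<omega> t))"
    using ws by (simp add: weak_solution_def)
  show "continuous_on UNIV q" "continuous_on UNIV p" "continuous_on UNIV \<omega>"
    using continuous_on_fst[OF continuous_on_fst[OF c]] continuous_on_snd[OF continuous_on_fst[OF c]]
      continuous_on_snd[OF c] by simp_all
qed

text \<open>Continuity of the solution makes the integrand continuous, so the integrated equation
  can be differentiated. All couplings are gathered in one time-dependent generator.\<close>

lemma weak_solution_spin_derivative:
  "((\<lambda>t. blinfun_apply (\<omega> t) Y) has_real_derivative
    blinfun_apply (\<omega> t) (lie_bracket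
      (\<Sum>l\<in>UNIV. \<Sum>m\<in>UNIV. (\<beta> $ m + B_field chi m (x l) (q t, p t)) *\<^sub>R i_sigma l m) Y)) (at t)"
proof -
  let ?f = "\<lambda>s. \<Sum>l\<in>UNIV. \<Sum>m\<in>UNIV. (\<beta> $ m + B_field chi m (x l) (q s, p s))
            * blinfun_apply (\<omega> s) (lie_bracket (i_sigma l m) Y)"
  have "((\<lambda>t. blinfun_apply (\<omega> t) Y) has_real_derivative ?f t) (at t)"
  proof (rule has_oriented_integral_derivative_real)
    show "continuous_on UNIV ?f"
      unfolding B_field.simps by (intro continuous_intros weak_solution_continuous)
    show "has_oriented_integral ?f (blinfun_apply (\<omega> t) Y - blinfun_apply (\<omega> 0) Y) 0 t" for t
      using ws unfolding weak_solution_def by blast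
  qed
  then show ?thesis
    by (simp only: linear_sum[OF linear_lie_bracket_left] linear_scale[OF linear_lie_bracket_left]
        blinfun.sum_right blinfun.scaleR_right real_scaleR_def)
qed

lemma weak_solution_norm_derivative:
  "((\<lambda>t. (norm (q t))\<^sup>2 + (norm (p t))\<^sup>2) has_real_derivative
    2 * h * (\<Sum>l\<in>UNIV. \<Sum>m\<in>UNIV. B_field chi m (x l) (symplectic_map (q t, p t))
      * blinfun_apply (\<omega> t) (i_sigma l m))) (at t)"
proof -
  define Q where "Q = (\<lambda>s. h *\<^sub>R (\<Sum>l\<in>UNIV. \<Sum>m\<in>UNIV. blinfun_apply (\<omega> s) (i_sigma l m) *\<^sub>R b_vec chi m (x l)))"
  define P where "P = (\<lambda>s. - (h *\<^sub>R (\<Sum>l\<in>UNIV. \<Sum>m\<in>UNIV. blinfun_apply (\<omega> s) (i_sigma l m) *\<^sub>R a_vec chi m (x l))))"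
  define Z where "Z = (\<lambda>t. free_flow (- t) (q t, p t))"
  have int: "has_oriented_integral (\<lambda>s. free_flow (t - s) (Q s, P s))
      ((q t, p t) - free_flow t (q 0, p 0)) 0 t" for t
    using ws unfolding weak_solution_def Q_def P_def Let_def by blast
  have "(Z has_vector_derivative free_flow (- t) (Q t, P t)) (at t)"
  proof (rule has_oriented_integral_derivative)
    show "continuous_on UNIV (\<lambda>s. free_flow (- s) (Q s, P s))"
      unfolding Q_def P_def
      by (intro continuous_on_free_flow continuous_intros weak_solution_continuous)
    fix t
    \<comment> \<open>The group law removes \<open>t\<close> from the integrand, leaving a fixed
      function of \<open>s\<close>.\<close>
    have "has_oriented_integral (\<lambda>s. free_flow (- t) (free_flow (t - s) (Q s, P s)))
        (free_flow (- t) ((q t, p t) - free_flow t (q 0, p 0))) 0 t"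
      by (rule has_oriented_integral_linear[OF int bounded_linear_free_flow])
    then show "has_oriented_integral (\<lambda>s. free_flow (- s) (Q s, P s)) (Z t - (q 0, p 0)) 0 t"
      by (simp add: linear_diff[OF linear_free_flow] free_flow_0 Z_def flip: free_flow_plus)
  qed
  then have "((\<lambda>t. Z t \<bullet> Z t) has_vector_derivative
      Z t \<bullet> free_flow (- t) (Q t, P t) + free_flow (- t) (Q t, P t) \<bullet> Z t) (at t)"
    by (intro bounded_bilinear.has_vector_derivative[OF bounded_bilinear_inner])
  then have "((\<lambda>t. Z t \<bullet> Z t) has_real_derivative 2 * (Z t \<bullet> free_flow (- t) (Q t, P t))) (at t)"
    unfolding has_real_derivative_iff_has_vector_derivative
    by (simp only: inner_commute[of _ "Z t"] mult_2)
  moreover have "Z t \<bullet> Z t = (norm (q t))\<^sup>2 + (norm (p t))\<^sup>2" for t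
    by (simp add: Z_def inner_free_flow power2_norm_eq_inner)
  \<comment> \<open>The flow cancels by isometry. In \<open>Q\<close> the vectors b are paired with
    q, in \<open>P\<close> the vectors -a with p: this is B evaluated at (-p, q).\<close>
  moreover have "Z t \<bullet> free_flow (- t) (Q t, P t) = h * (\<Sum>l\<in>UNIV. \<Sum>m\<in>UNIV.
      B_field chi m (x l) (symplectic_map (q t, p t)) * blinfun_apply (\<omega> t) (i_sigma l m))"
    by (simp add: Z_def inner_free_flow Q_def P_def inner_sum_right inner_commute[of "q t"]
        inner_commute[of "p t"] algebra_simps sum.distrib sum_subtractf)
  ultimately show ?thesis
    by (simp only: mult.assoc)
qed

end

theorem mainTheorem6:
  fixes chi :: "real \<Rightarrow> real" and h :: real and \<beta> :: "real^3"
    and x :: "'n::finite \<Rightarrow> real^3"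
    and q p :: "real \<Rightarrow> tfield" and \<omega> :: "real \<Rightarrow> ('n su \<Rightarrow>\<^sub>L real)"
  assumes "schwartz chi" and "\<forall>\<^sub>F r in nhds 0. chi r = 0"
    and "h > 0"
    and "weak_solution chi h \<beta> x q p \<omega>"
    and "\<omega> 0 \<in> Omega"
  shows "(\<forall>t. \<omega> t \<in> Omega) \<and>
    (\<forall>t. ((\<lambda>t. N_appr h (q t) (p t)) has_real_derivative
       (\<Sum>l\<in>UNIV. \<Sum>j\<in>UNIV.
          (E_field chi j (x l) (Pi_minus (q t, p t)) - E_field chi j (x l) (Pi_plus (q t, p t)))
            * S_appr (\<omega> t) l j)) (at t))"
proof (intro conjI allI)
  show "\<omega> t \<in> Omega" for t
    using weak_solution_spin_derivative[OF assms(4)] assms(5) by (rule coadjoint_flow_preserves_Omega)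
  fix t
  show "((\<lambda>t. N_appr h (q t) (p t)) has_real_derivative
       (\<Sum>l\<in>UNIV. \<Sum>j\<in>UNIV.
          (E_field chi j (x l) (Pi_minus (q t, p t)) - E_field chi j (x l) (Pi_plus (q t, p t)))
            * S_appr (\<omega> t) l j)) (at t)"
    using DERIV_cdivide[OF weak_solution_norm_derivative[OF assms(4)], of "2 * h" t] \<open>h > 0\<close>
    by (simp add: N_appr_def E_field_Pi_diff S_appr_def)
qed

end
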